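(* Suppose that a dynamical system $(X,f)$ is uniquely ergodic, minimal, totally transitive, but not topologically weakly mixing. Then for every $m\geq 2$ there exists a non-uniform $A\in C(X,\mathrm{GL}(m))$.
   Context: A dynamical system $(X,f)$ is a compact metric space $X$ together with a homeomorphism $f:X\to X$. It is minimal if for every $x\in X$ the forward orbit $\{f^i x: i\in\mathbb{N}\}$ is dense in $X$ ($\mathbb{N}$ includes $0$, $\mathbb{N}^+$ denotes the positive integers). It is uniquely ergodic if there is exactly one $f$-invariant Borel probability measure on $X$. It is topologically transitive if for all non-empty open $U,V\subset X$ there is $k\in\mathbb{N}^+$ with $f^k(U)\cap V\neq\emptyset$; totally transitive if $(X,f^n)$ is topologically transitive for every $n\in\mathbb{N}^+$; topologically weakly mixing if $(X\times X,f\times f)$ is topologically transitive. $\mathrm{GL}(m)$ is the set of invertible real $m\times m$ matrices and $C(X,\mathrm{GL}(m))$ is the set of continuous maps $X\to\mathrm{GL}(m)$. For $A\in C(X,\mathrm{GL}(m))$ and $n\geq1$ put $A(n,x)=A(f^{n-1}x)A(f^{n-2}x)\cdots A(x)$. $A$ is uniform if $\frac1n\log\|A(n,x)\|$ converges uniformly on $X$ as $n\to\infty$ (this does not depend on the choice of matrix norm), and non-uniform otherwise. *)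

theory Defs
  imports "HOL-Probability.Probability"
begin

text \<open>
  A dynamical system is a compact subset \<open>X\<close> of a metric space (with the induced metric and
  topology) and a map \<open>f\<close> that restricts to a homeomorphism of \<open>X\<close>; the values of \<open>f\<close>
  outside \<open>X\<close> play no role.
\<close>

definition dynamical_system :: "'a::metric_space set \<Rightarrow> ('a \<Rightarrow> 'a) \<Rightarrow> bool" where
  "dynamical_system X f \<longleftrightarrow> compact X \<and> (\<exists>g. homeomorphism X X f g)"

definition minimal_system :: "'a::metric_space set \<Rightarrow> ('a \<Rightarrow> 'a) \<Rightarrow> bool" where
  "minimal_system X f \<longleftrightarrow> (\<forall>x\<in>X. X \<subseteq> closure {(f ^^ i) x | i. True})"

definition invariant_prob :: "'a::metric_space set \<Rightarrow> ('a \<Rightarrow> 'a) \<Rightarrow> 'a measure \<Rightarrow> bool" where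
  "invariant_prob X f M \<longleftrightarrow>
     prob_space M \<and> sets M = sets (restrict_space borel X) \<and>
     f \<in> measurable M M \<and> distr M M f = M"

definition uniquely_ergodic :: "'a::metric_space set \<Rightarrow> ('a \<Rightarrow> 'a) \<Rightarrow> bool" where
  "uniquely_ergodic X f \<longleftrightarrow> (\<exists>!M. invariant_prob X f M)"

definition top_transitive :: "'a::metric_space set \<Rightarrow> ('a \<Rightarrow> 'a) \<Rightarrow> bool" where
  "top_transitive X f \<longleftrightarrow>
     (\<forall>U V. openin (top_of_set X) U \<and> openin (top_of_set X) V \<and> U \<noteq> {} \<and> V \<noteq> {} \<longrightarrow>
        (\<exists>k\<ge>1. (f ^^ k) ` U \<inter> V \<noteq> {}))"

definition totally_transitive :: "'a::metric_space set \<Rightarrow> ('a \<Rightarrow> 'a) \<Rightarrow> bool" where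
  "totally_transitive X f \<longleftrightarrow> (\<forall>n\<ge>1. top_transitive X (f ^^ n))"

definition top_weakly_mixing :: "'a::metric_space set \<Rightarrow> ('a \<Rightarrow> 'a) \<Rightarrow> bool" where
  "top_weakly_mixing X f \<longleftrightarrow> top_transitive (X \<times> X) (map_prod f f)"

definition C_GL :: "'a::metric_space set \<Rightarrow> ('a \<Rightarrow> real ^ 'm ^ 'm) set" where
  "C_GL X = {A. continuous_on X A \<and> (\<forall>x\<in>X. invertible (A x))}"

primrec cocycle :: "('a \<Rightarrow> 'a) \<Rightarrow> ('a \<Rightarrow> real ^ 'm ^ 'm) \<Rightarrow> nat \<Rightarrow> 'a \<Rightarrow> real ^ 'm ^ 'm" where
  "cocycle f A 0 x = mat 1"
| "cocycle f A (Suc n) x = A ((f ^^ n) x) ** cocycle f A n x"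

text \<open>
  The matrix norm is the operator norm for the Euclidean norm. The limit function is not
  required to be constant.
\<close>

definition uniform_cocycle ::
    "'a::metric_space set \<Rightarrow> ('a \<Rightarrow> 'a) \<Rightarrow> ('a \<Rightarrow> real ^ 'm ^ 'm) \<Rightarrow> bool" where
  "uniform_cocycle X f A \<longleftrightarrow>
     uniformly_convergent_on X (\<lambda>n x. ln (onorm ((*v) (cocycle f A n x))) / real n)"

end

theory Submission
  imports Defs "HOL-Complex_Analysis.Conformal_Mappings"
begin

text \<open>
  Let \<open>M\<close> be the invariant measure. As \<open>(X, f)\<close> is not weakly mixing, some nonempty open
  \<open>W \<subseteq> X \<times> X\<close>, backward invariant under \<open>f \<times> f\<close>, is not dense. The measure of the section
  \<open>W x\<close> is lower semicontinuous in \<open>x\<close> and does not increase along orbits, so by minimality it is a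
  constant \<open>c\<close> with \<open>0 < c < 1\<close>, and the preimage of \<open>W (f x)\<close> equals \<open>W x\<close> up to a null set. Hence
  \<open>K x y = M (W x \<inter> W y) - c\<^sup>2\<close> is a continuous, invariant, positive definite kernel with
  \<open>K x x > 0\<close> and, by Fubini, mean zero. A Fejer kernel estimate yields
  frequencies along which the averages of \<open>K\<close> over an orbit do not decay; a limit \<open>l \<noteq> 1\<close> of these
  frequencies satisfies \<open>\<delta> \<bar>l\<^sup>j - 1\<bar> \<le> K x x - K (f\<^sup>j x) x\<close>, so \<open>f\<^sup>j x \<mapsto> l\<^sup>j\<close> extends to a
  continuous eigenfunction \<open>g\<close>. By total transitivity \<open>l\<close> is not a root of unity, and \<open>g\<close> is a factor
  map onto an irrational rotation.

  Over the rotation we use Herman's cocycle \<open>z \<mapsto> diag(2, 1/2) R\<^sub>z\<close>, where \<open>R\<^sub>z\<close> is the rotation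
  by \<open>z\<close>. The maximum principle
  bounds the maximum over the circle of the norm of the \<open>n\<close>-step cocycle from below by a multiple of
  \<open>(5/4)\<^sup>n\<close>, while a winding number argument shows that its minimum stays bounded. Uniform convergence
  would force the two exponential rates to agree.
\<close>

section \<open>Exponential sums of positive definite sequences\<close>

text \<open>The summand is the \<open>k\<close>-th power of a single root of unity, so this is a
  geometric sum. The bounds \<open>p, q < R\<close> keep \<open>p - q\<close> strictly between
  \<open>- R\<close> and \<open>R\<close>, where 0 is the only multiple of \<open>R\<close>.\<close>

lemma roots_unity_orthogonality:
  assumes "p < R" "q < R"
  shows "(\<Sum>k<R. cis (2 * pi * real k / real R) ^ p * cnj (cis (2 * pi * real k / real R)) ^ q)
    = (if p = q then of_nat R else 0)"
proof -
  define x where "x = cis (2 * pi * ((real p - real q) / real R))"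
  have R: "R > 0" using assms by simp
  have "cis (2 * pi * real k / real R) ^ p * cnj (cis (2 * pi * real k / real R)) ^ q = x ^ k" for k
    by (simp add: x_def Complex.DeMoivre cis_cnj cis_mult diff_divide_distrib algebra_simps)
  then have "(\<Sum>k<R. cis (2 * pi * real k / real R) ^ p * cnj (cis (2 * pi * real k / real R)) ^ q) = (\<Sum>k<R. x ^ k)"
    by simp
  also have "\<dots> = (if p = q then of_nat R else 0)"
  proof (cases "p = q")
    case False
    have "x \<noteq> 1"
    proof
      assume "x = 1"
      then have "cos (2 * pi * ((real p - real q) / real R)) = 1"
        by (metis Re_complex_of_real cis.sel(1) of_real_1 x_def)
      then obtain k :: int where "2 * pi * ((real p - real q) / real R) = of_int k * 2 * pi"
        by (auto simp: cos_one_2pi_int)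
      then have "2 * pi * ((real p - real q) / real R) = 2 * pi * of_int k" by (simp only: mult_ac)
      then have "(real p - real q) / real R = of_int k" by (subst (asm) mult_cancel_left) simp
      then have "real p - real q = of_int k * real R" using R by (simp add: field_simps)
      then have eq: "int p - int q = k * int R"
        by (metis of_int_diff of_int_eq_iff of_int_mult of_int_of_nat_eq)
      then have "int R dvd int p - int q" by simp
      moreover have "\<bar>int p - int q\<bar> < int R" "int p - int q \<noteq> 0" using assms False by auto
      ultimately show False using zdvd_not_zless[of "\<bar>int p - int q\<bar>" "int R"] by auto
    qed
    have "x ^ R = cis (2 * pi * of_int (int p - int q))"
      using R by (simp add: x_def Complex.DeMoivre)
    also have "\<dots> = 1" by (rule cis_multiple_2pi) simp
    finally have "x ^ R = 1" .
    then show ?thesis using False \<open>x \<noteq> 1\<close> by (simp add: sum_gp_strict)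
  qed (simp add: x_def)
  finally show ?thesis .
qed

text \<open>\<open>sym\<close> and \<open>inv\<close> make \<open>G n m\<close> depend only on the
  distance between \<open>n\<close> and \<open>m\<close>, and the last hypothesis says that
  \<open>n' - m'\<close> is the negative of \<open>n - m\<close>.\<close>

lemma toeplitz_eq:
  fixes G :: "nat \<Rightarrow> nat \<Rightarrow> 'b"
  assumes sym: "\<And>n m. G n m = G m n" and inv: "\<And>n m. G (Suc n) (Suc m) = G n m"
    and "n + n' = m + m'"
  shows "G n' m' = G n m"
proof -
  have shift: "G (n + k) (m + k) = G n m" for n m k
    by (induction k) (auto simp: inv)
  show ?thesis
  proof (cases "m \<le> n")
    case True
    define d where "d = n - m"
    have "n = d + m" "m' = d + n'" using True assms(3) by (auto simp: d_def)
    then show ?thesis using shift[of d m 0] shift[of d n' 0] sym by (metis add_0)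
  next
    case False
    define d where "d = m - n"
    have "m = d + n" "n' = d + m'" using False assms(3) by (auto simp: d_def)
    then show ?thesis using shift[of d n 0] shift[of d m' 0] sym by (metis add_0)
  qed
qed

text \<open>The Fejer sums \<open>S w\<close> are nonnegative; over the \<open>2 N\<close>-th roots of unity their mean is \<open>N b\<close>
  and their mean square is at least \<open>P \<Sum> (G n m)\<^sup>2\<close> over \<open>n, m < P = N / 2\<close>. The maximum
  dominates the quotient of the two.\<close>
lemma ex_large_exponential_sum:
  fixes G :: "nat \<Rightarrow> nat \<Rightarrow> real"
  assumes sym: "\<And>n m. G n m = G m n" and inv: "\<And>n m. G (Suc n) (Suc m) = G n m"
    and b: "G 0 0 = b" "b > 0"
    and psd: "\<And>N w. norm w = 1 \<Longrightarrow> 0 \<le> Re (\<Sum>n<N. \<Sum>m<N. w ^ n * cnj w ^ m * of_real (G n m))"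
    and L: "\<And>n m. \<exists>k<L. b / 2 \<le> G (n + k) m"
    and Q: "Q \<ge> 1" and N: "N = 2 * (L * Q)"
  shows "\<exists>(w::complex) m. norm w = 1 \<and> b / (32 * real L) * real N \<le> norm (\<Sum>n<N. w ^ n * of_real (G n m))"
proof -
  define P where "P = L * Q"
  \<comment> \<open>A product of two terms of \<open>S\<close> has exponents up to
    \<open>2 * N - 2\<close>, which must stay below \<open>R\<close> for \<open>orth\<close> to
    apply.\<close>
  define R where "R = 2 * N"
  define \<omega> where "\<omega> = (\<lambda>k::nat. cis (2 * pi * real k / real R))"
  define I where "I = {..<N} \<times> {..<N}"
  define S where "S = (\<lambda>w. \<Sum>n<N. \<Sum>m<N. w ^ n * cnj w ^ m * complex_of_real (G n m))"
  have L0: "L > 0" using L[of 0 0] by auto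
  have N0: "N > 0" using L0 Q N by simp
  have NP: "N = 2 * P" using N by (simp add: P_def)
  have diag: "G n n = b" for n
    by (induction n) (auto simp: b inv)
  have \<omega>1: "norm (\<omega> k) = 1" for k by (simp add: \<omega>_def)
  have orth: "(\<Sum>k<R. \<omega> k ^ p * cnj (\<omega> k) ^ q) = (if p = q then of_nat R else 0)" if "p < R" "q < R" for p q
    unfolding \<omega>_def using roots_unity_orthogonality[OF that] .
  have S_I: "S w = (\<Sum>x\<in>I. w ^ fst x * cnj w ^ snd x * complex_of_real (G (fst x) (snd x)))" for w
    unfolding S_def I_def sum.cartesian_product by (simp add: case_prod_beta)
  have S_real: "S w = of_real (Re (S w))" for w
  proof -
    have "cnj (S w) = (\<Sum>n<N. \<Sum>m<N. w ^ m * cnj w ^ n * complex_of_real (G m n))"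
      unfolding S_def cnj_sum using sym by (simp add: mult.commute)
    also have "\<dots> = S w" unfolding S_def by (rule sum.swap)
    finally have "S w \<in> \<real>" by (simp add: Reals_cnj_iff)
    then show ?thesis by simp
  qed
  have sum1: "(\<Sum>k<R. Re (S (\<omega> k))) = real R * real N * b"
  proof -
    have "(\<Sum>k<R. S (\<omega> k)) = (\<Sum>n<N. \<Sum>m<N. \<Sum>k<R. \<omega> k ^ n * cnj (\<omega> k) ^ m * complex_of_real (G n m))"
      unfolding S_def by (subst sum.swap, subst sum.swap) (rule refl)
    also have "\<dots> = (\<Sum>n<N. \<Sum>m<N. (if n = m then of_nat R else 0) * complex_of_real (G n m))"
      by (intro sum.cong refl, subst sum_distrib_right[symmetric], subst orth) (auto simp: R_def)
    also have "\<dots> = (\<Sum>n<N. \<Sum>m<N. (if n = m then of_nat R * complex_of_real b else 0))"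
      by (intro sum.cong refl) (auto simp: diag)
    also have "\<dots> = of_real (real R * real N * b)"
      by (simp add: sum.delta')
    finally have "Re (\<Sum>k<R. S (\<omega> k)) = real R * real N * b" by (simp only: Re_complex_of_real)
    then show ?thesis by simp
  qed
  \<comment> \<open>\<open>T\<close> is the mean square of \<open>S\<close> over the roots of unity:
    orthogonality keeps the quadruples of indices with matching exponents, and on these
    \<open>toeplitz_eq\<close> makes the two values of \<open>G\<close> coincide.\<close>
  define T where "T = (\<Sum>x\<in>I. \<Sum>y\<in>I. if fst x + fst y = snd x + snd y then (G (fst x) (snd x))\<^sup>2 else 0)"
  have sum2: "(\<Sum>k<R. (Re (S (\<omega> k)))\<^sup>2) = real R * T"
  proof -
    have "(\<Sum>k<R. S (\<omega> k) * S (\<omega> k)) = (\<Sum>k<R. \<Sum>x\<in>I. \<Sum>y\<in>I. \<omega> k ^ (fst x + fst y) * cnj (\<omega> k) ^ (snd x + snd y) *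
        (complex_of_real (G (fst x) (snd x)) * complex_of_real (G (fst y) (snd y))))"
      unfolding S_I sum_product by (intro sum.cong refl) (simp add: power_add algebra_simps)
    also have "\<dots> = (\<Sum>x\<in>I. \<Sum>y\<in>I. \<Sum>k<R. \<omega> k ^ (fst x + fst y) * cnj (\<omega> k) ^ (snd x + snd y) *
        (complex_of_real (G (fst x) (snd x)) * complex_of_real (G (fst y) (snd y))))"
      by (subst sum.swap, subst sum.swap) (rule refl)
    also have "\<dots> = (\<Sum>x\<in>I. \<Sum>y\<in>I. (if fst x + fst y = snd x + snd y then of_nat R else 0) *
        (complex_of_real (G (fst x) (snd x)) * complex_of_real (G (fst y) (snd y))))"
      by (intro sum.cong refl, subst sum_distrib_right[symmetric], subst orth) (auto simp: R_def I_def)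
    also have "\<dots> = (\<Sum>x\<in>I. \<Sum>y\<in>I. of_nat R * of_real (if fst x + fst y = snd x + snd y then (G (fst x) (snd x))\<^sup>2 else 0))"
      by (intro sum.cong refl) (auto simp: power2_eq_square toeplitz_eq[of G, OF sym inv])
    also have "\<dots> = of_real (real R * T)"
      by (simp add: T_def sum_distrib_left)
    finally have "(\<Sum>k<R. S (\<omega> k) * S (\<omega> k)) = of_real (real R * T)" .
    moreover have "S (\<omega> k) * S (\<omega> k) = of_real ((Re (S (\<omega> k)))\<^sup>2)" for k
      by (subst (1 2) S_real) (simp add: power2_eq_square)
    ultimately have "complex_of_real (\<Sum>k<R. (Re (S (\<omega> k)))\<^sup>2) = of_real (real R * T)"
      by simp
    then show ?thesis by (simp only: of_real_eq_iff)
  qed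
  have T_ge: "real P * real P * real Q * (b / 2)\<^sup>2 \<le> T"
  proof -
    \<comment> \<open>The range \<open>{..<P}\<close> splits into \<open>Q\<close> blocks of length
      \<open>L\<close>, and by hypothesis each of them contains an index where \<open>G\<close> is
      at least \<open>b / 2\<close>.\<close>
    have blk: "real Q * (b / 2)\<^sup>2 \<le> (\<Sum>n<P. (G n m)\<^sup>2)" for m
    proof -
      have "(b / 2)\<^sup>2 \<le> (\<Sum>n\<in>{q * L..<q * L + L}. (G n m)\<^sup>2)" for q
      proof -
        obtain k where k: "k < L" "b / 2 \<le> G (q * L + k) m" using L by blast
        have "(b / 2)\<^sup>2 \<le> (G (q * L + k) m)\<^sup>2" using k b by (intro power_mono) auto
        also have "\<dots> \<le> (\<Sum>n\<in>{q * L..<q * L + L}. (G n m)\<^sup>2)"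
          using k by (intro member_le_sum) auto
        finally show ?thesis .
      qed
      then have "(\<Sum>q<Q. (b / 2)\<^sup>2) \<le> (\<Sum>q<Q. \<Sum>n\<in>{q * L..<q * L + L}. (G n m)\<^sup>2)"
        by (intro sum_mono)
      also have "\<dots> = (\<Sum>n<P. (G n m)\<^sup>2)"
        unfolding P_def by (simp add: sum.nat_group mult.commute)
      finally show ?thesis by simp
    qed
    \<comment> \<open>The pairs \<open>(m + t, n + t)\<close> with \<open>t < P\<close> solve the
      index equation; they lie in \<open>I\<close> because \<open>n\<close>, \<open>m\<close> and
      \<open>t\<close> are all below \<open>P = N / 2\<close>.\<close>
    have cnt: "real P * (G n m)\<^sup>2 \<le> (\<Sum>y\<in>I. if n + fst y = m + snd y then (G n m)\<^sup>2 else 0)" if nm: "n < P" "m < P" for n m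
    proof -
      have "real P * (G n m)\<^sup>2 = (\<Sum>y\<in>(\<lambda>t. (m + t, n + t)) ` {..<P}. (G n m)\<^sup>2)"
        by (subst sum.reindex) (auto simp: inj_on_def)
      also have "\<dots> = (\<Sum>y\<in>(\<lambda>t. (m + t, n + t)) ` {..<P}. if n + fst y = m + snd y then (G n m)\<^sup>2 else 0)"
        by (intro sum.cong) auto
      also have "\<dots> \<le> (\<Sum>y\<in>I. if n + fst y = m + snd y then (G n m)\<^sup>2 else 0)"
        using nm by (intro sum_mono2) (auto simp: I_def NP)
      finally show ?thesis .
    qed
    have "real P * real P * real Q * (b / 2)\<^sup>2 = real P * (\<Sum>m<P. real Q * (b / 2)\<^sup>2)"
      by simp
    also have "\<dots> \<le> real P * (\<Sum>m<P. \<Sum>n<P. (G n m)\<^sup>2)"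
      by (intro mult_left_mono sum_mono blk) auto
    also have "\<dots> = (\<Sum>n<P. \<Sum>m<P. real P * (G n m)\<^sup>2)"
      by (subst sum.swap) (simp add: sum_distrib_left)
    also have "\<dots> \<le> (\<Sum>n<P. \<Sum>m<P. \<Sum>y\<in>I. if n + fst y = m + snd y then (G n m)\<^sup>2 else 0)"
      by (intro sum_mono cnt) auto
    also have "\<dots> = (\<Sum>x\<in>{..<P} \<times> {..<P}. \<Sum>y\<in>I. if fst x + fst y = snd x + snd y then (G (fst x) (snd x))\<^sup>2 else 0)"
      by (subst sum.cartesian_product) (simp add: case_prod_beta)
    also have "\<dots> \<le> T"
      unfolding T_def
    proof (rule sum_mono2)
      show "{..<P} \<times> {..<P} \<subseteq> I" by (auto simp: I_def NP)
    qed (auto simp: I_def intro: sum_nonneg)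
    finally show ?thesis .
  qed
  define M where "M = Max ((\<lambda>k. Re (S (\<omega> k))) ` {..<R})"
  have R0: "R > 0" using N0 by (simp add: R_def)
  have Mge: "Re (S (\<omega> k)) \<le> M" if "k < R" for k
    unfolding M_def using that by (intro Max_ge) auto
  have "M \<in> (\<lambda>k. Re (S (\<omega> k))) ` {..<R}"
    unfolding M_def using R0 by (intro Max_in) auto
  then obtain k where k: "M = Re (S (\<omega> k))" by blast
  have S_nonneg: "0 \<le> Re (S (\<omega> k))" for k
    unfolding S_def by (rule psd[OF \<omega>1])
  \<comment> \<open>As the sums are nonnegative, each square is at most \<open>M\<close> times the
    sum itself.\<close>
  have "real R * T \<le> (\<Sum>k<R. M * Re (S (\<omega> k)))"
    unfolding sum2[symmetric] power2_eq_square
    by (intro sum_mono mult_right_mono Mge S_nonneg) auto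
  also have "\<dots> = real R * (M * real N * b)"
    unfolding sum_distrib_left[symmetric] sum1 by simp
  finally have "T \<le> M * real N * b" using R0 by simp
  with T_ge have "real P * real P * real Q * (b / 2)\<^sup>2 \<le> M * real N * b" by linarith
  then have "real L * real L * real Q * real Q * real Q * b * b \<le> 8 * M * real L * real Q * b"
    unfolding N P_def by (simp add: power2_eq_square field_simps)
  then have "(real L * real Q * b) * (real L * real Q * real Q * b) \<le> (real L * real Q * b) * (8 * M)"
    by (simp add: mult_ac)
  then have "real L * real Q * real Q * b \<le> 8 * M"
    using L0 Q b by (subst (asm) mult_le_cancel_left_pos) auto
  \<comment> \<open>With \<open>N = 2 * (L * Q)\<close>, the quantity
    \<open>L * Q\<^sup>2 * b / 8\<close> equals \<open>b * N\<^sup>2 / (32 * L)\<close>, which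
    explains the constant 32.\<close>
  then have M_ge: "b / (32 * real L) * real N * real N \<le> M"
    using L0 unfolding N by (simp add: field_simps)
  show ?thesis
  proof (rule ccontr)
    assume "\<not> ?thesis"
    then have small: "norm (\<Sum>n<N. \<omega> k ^ n * of_real (G n m)) < b / (32 * real L) * real N" for m
      using \<omega>1[of k] by (meson not_le)
    have "M \<le> norm (S (\<omega> k))" unfolding k by (rule complex_Re_le_cmod)
    \<comment> \<open>The column sums enter \<open>S\<close> with unimodular weights, so some column
      carries at least the fraction \<open>1 / N\<close> of the maximum.\<close>
    also have "S (\<omega> k) = (\<Sum>m<N. cnj (\<omega> k) ^ m * (\<Sum>n<N. \<omega> k ^ n * of_real (G n m)))"
      unfolding S_def by (subst sum.swap) (simp add: sum_distrib_left mult_ac)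
    also have "norm \<dots> \<le> (\<Sum>m<N. norm (\<Sum>n<N. \<omega> k ^ n * of_real (G n m)))"
      by (rule sum_norm_le) (simp add: norm_mult norm_power \<omega>1)
    also have "\<dots> < (\<Sum>m<N. b / (32 * real L) * real N)"
      using N0 small by (intro sum_strict_mono) auto
    also have "\<dots> = b / (32 * real L) * real N * real N" by simp
    finally show False using M_ge by linarith
  qed
qed

text \<open>Moving the window by one place drops one term and adds another, which costs at most
  \<open>2 * C\<close>.\<close>

lemma exponential_sum_shift:
  fixes c :: "nat \<Rightarrow> complex"
  assumes w: "norm w = 1" and c: "\<And>n. norm (c n) \<le> C"
  shows "norm ((\<Sum>n<N. w ^ (n + j) * c (n + j)) - (\<Sum>n<N. w ^ n * c n)) \<le> 2 * real j * C"
proof (induction j)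
  case (Suc j)
  define e where "e = (\<lambda>j. \<Sum>n<N. w ^ (n + j) * c (n + j))"
  have "e (Suc j) + w ^ j * c j = e j + w ^ (N + j) * c (N + j)"
    unfolding e_def by (induction N) (auto simp: algebra_simps)
  then have "e (Suc j) - e j = w ^ (N + j) * c (N + j) - w ^ j * c j"
    by (simp add: algebra_simps)
  then have "norm (e (Suc j) - e j) \<le> norm (c (N + j)) + norm (c j)"
    using norm_triangle_ineq4[of "w ^ (N + j) * c (N + j)" "w ^ j * c j"] w
    by (simp add: norm_mult norm_power)
  also have "\<dots> \<le> 2 * C" using c[of "N+j"] c[of j] by linarith
  finally have 1: "norm (e (Suc j) - e j) \<le> 2 * C" .
  have "norm (e (Suc j) - (\<Sum>n<N. w ^ n * c n)) \<le> norm (e (Suc j) - e j) + norm (e j - (\<Sum>n<N. w ^ n * c n))"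
    using norm_triangle_ineq[of "e (Suc j) - e j" "e j - (\<Sum>n<N. w ^ n * c n)"] by simp
  with 1 Suc show ?case unfolding e_def by (simp add: algebra_simps)
qed auto

lemma norm_power_diff_1_le:
  fixes w :: complex
  assumes "norm w = 1"
  shows "norm (w ^ n - 1) \<le> real n * norm (w - 1)"
proof (induction n)
  case (Suc n)
  have "w ^ Suc n - 1 = w * (w ^ n - 1) + (w - 1)" by (simp add: algebra_simps)
  then have "norm (w ^ Suc n - 1) \<le> norm (w ^ n - 1) + norm (w - 1)"
    using norm_triangle_ineq[of "w * (w ^ n - 1)" "w - 1"] assms unfolding \<open>w ^ Suc n - 1 = _\<close> by (simp add: norm_mult)
  with Suc show ?case by (simp add: algebra_simps)
qed auto

text \<open>The large exponential sums over longer and longer windows have frequencies on the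
  compact unit circle, and \<open>l\<close> is one of their limit points. Comparing each sum with
  its shifts gives the inequality in the limit, and the small averages in \<open>avg\<close> exclude
  \<open>l = 1\<close>.\<close>

lemma ex_eigenvalue:
  fixes G :: "nat \<Rightarrow> nat \<Rightarrow> real"
  assumes sym: "\<And>n m. G n m = G m n" and inv: "\<And>n m. G (Suc n) (Suc m) = G n m"
    and b: "G 0 0 = b" "b > 0"
    and psd: "\<And>N w. norm w = 1 \<Longrightarrow> 0 \<le> Re (\<Sum>n<N. \<Sum>m<N. w ^ n * cnj w ^ m * of_real (G n m))"
    and L: "\<And>n m. \<exists>k<L. b / 2 \<le> G (n + k) m"
    and C: "\<And>n m. \<bar>G n m\<bar> \<le> C"
    and lip: "\<And>n m j. \<bar>G (n + j) m - G n m\<bar> \<le> b - G j 0"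
    and avg: "\<And>e. e > 0 \<Longrightarrow> \<exists>M\<ge>1. \<forall>n m. \<bar>\<Sum>i<M. G (n + i) m\<bar> \<le> e * real M"
  shows "\<exists>(l::complex) \<delta>. norm l = 1 \<and> l \<noteq> 1 \<and> \<delta> > 0 \<and> (\<forall>j. \<delta> * norm (l ^ j - 1) \<le> b - G j 0)"
proof -
  have L0: "L > 0" using L[of 0 0] by auto
  define \<delta> where "\<delta> = b / (32 * real L)"
  have \<delta>: "\<delta> > 0" using L0 b by (simp add: \<delta>_def)
  define N where "N = (\<lambda>Q. 2 * (L * Suc Q))"
  have N0: "N Q > 0" for Q using L0 by (simp add: N_def)
  have "\<exists>(w::complex) m. norm w = 1 \<and> \<delta> * real (N Q) \<le> norm (\<Sum>n<N Q. w ^ n * of_real (G n m))" for Q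
    unfolding \<delta>_def by (rule ex_large_exponential_sum[OF sym inv b psd L, where Q = "Suc Q"]) (auto simp: N_def)
  then obtain w m where w: "\<And>Q. norm (w Q :: complex) = 1"
    and big: "\<And>Q. \<delta> * real (N Q) \<le> norm (\<Sum>n<N Q. w Q ^ n * of_real (G n (m Q)))"
    by metis
  have "\<forall>Q. w Q \<in> sphere 0 1" using w by simp
  then obtain l r where l: "l \<in> sphere 0 1" "strict_mono r" "(w \<circ> r) \<longlonglongrightarrow> l"
    using compact_imp_seq_compact[OF compact_sphere[of "0::complex" 1]] unfolding seq_compact_def by metis
  have C0: "C \<ge> 0" using C[of 0 0] by linarith
  have wl: "(\<lambda>Q. w (r Q)) \<longlonglongrightarrow> l" using l(3) by (simp add: o_def)
  have Ninf: "(\<lambda>Q. K / real (N (r Q))) \<longlonglongrightarrow> 0" for K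
  proof -
    have "(\<lambda>Q. K / real (N Q)) \<longlonglongrightarrow> 0" unfolding N_def using L0 by real_asymp
    then show ?thesis using l(2) LIMSEQ_subseq_LIMSEQ by (fastforce simp: o_def)
  qed
  \<comment> \<open>The product \<open>w Q ^ j * V\<close> is the sum over the shifted window, hence
    close to \<open>U\<close>; by \<open>lip\<close> also \<open>V\<close> is close to
    \<open>U\<close>. So \<open>(w Q ^ j - 1) * U\<close> is small, while \<open>U\<close> is large
    by \<open>big\<close>.\<close>
  have step: "\<delta> * norm (w Q ^ j - 1) \<le> (b - G j 0) + 2 * real j * C / real (N Q)" for Q j
  proof -
    define c where "c = (\<lambda>n. complex_of_real (G n (m Q)))"
    define U where "U = (\<Sum>n<N Q. w Q ^ n * c n)"
    define V where "V = (\<Sum>n<N Q. w Q ^ n * c (n + j))"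
    have 1: "norm (w Q ^ j * V - U) \<le> 2 * real j * C"
      using exponential_sum_shift[OF w[of Q], of c C j "N Q"] C
      by (simp add: V_def U_def c_def sum_distrib_left power_add mult_ac)
    have "norm (V - U) \<le> (\<Sum>n<N Q. norm (w Q ^ n * (c (n + j) - c n)))"
      unfolding V_def U_def sum_subtractf[symmetric] right_diff_distrib[symmetric] by (rule norm_sum)
    also have "\<dots> \<le> (\<Sum>n<N Q. b - G j 0)"
      using lip by (intro sum_mono) (simp add: norm_mult norm_power w c_def flip: of_real_diff)
    finally have 2: "norm (V - U) \<le> real (N Q) * (b - G j 0)" by simp
    have "(w Q ^ j - 1) * U = (w Q ^ j * V - U) - w Q ^ j * (V - U)" by (simp add: algebra_simps)
    then have "norm (w Q ^ j - 1) * norm U \<le> norm (w Q ^ j * V - U) + norm (V - U)"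
      using norm_triangle_ineq4[of "w Q ^ j * V - U" "w Q ^ j * (V - U)"]
      by (simp add: norm_mult norm_power w flip: norm_mult[of "w Q ^ j - 1"])
    also have "\<dots> \<le> 2 * real j * C + real (N Q) * (b - G j 0)" using 1 2 by linarith
    finally have 3: "norm (w Q ^ j - 1) * norm U \<le> 2 * real j * C + real (N Q) * (b - G j 0)" .
    have "norm (w Q ^ j - 1) * (\<delta> * real (N Q)) \<le> norm (w Q ^ j - 1) * norm U"
      using big[of Q] by (intro mult_left_mono) (auto simp: U_def c_def)
    with 3 have "norm (w Q ^ j - 1) * (\<delta> * real (N Q)) \<le> 2 * real j * C + real (N Q) * (b - G j 0)"
      by linarith
    then show ?thesis using N0[of Q] by (simp add: field_simps)
  qed
  have bound: "\<delta> * norm (l ^ j - 1) \<le> b - G j 0" for j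
  proof (rule LIMSEQ_le)
    show "(\<lambda>Q. \<delta> * norm (w (r Q) ^ j - 1)) \<longlonglongrightarrow> \<delta> * norm (l ^ j - 1)"
      by (intro tendsto_intros wl)
    show "(\<lambda>Q. (b - G j 0) + 2 * real j * C / real (N (r Q))) \<longlonglongrightarrow> b - G j 0"
      using tendsto_add[OF tendsto_const Ninf, of "b - G j 0"] by simp
  qed (use step in blast)
  have "l \<noteq> 1"
  proof
    assume l1: "l = 1"
    obtain M where M: "M \<ge> 1" "\<And>n m. \<bar>\<Sum>i<M. G (n + i) m\<bar> \<le> \<delta> / 2 * real M"
      using avg[of "\<delta> / 2"] \<delta> by auto
    \<comment> \<open>Replace \<open>U\<close> by the average of its first \<open>M\<close> shifts
      and sum over windows of length \<open>M\<close>. The errors come from the shifts, from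
      \<open>avg\<close>, and from putting 1 for \<open>w Q ^ i\<close> inside a window. If
      \<open>w Q\<close> tends to 1, only \<open>\<delta> / 2\<close> remains on the right.\<close>
    have est: "\<delta> \<le> 2 * real M * C / real (N Q) + (\<delta> / 2 + real M * C * norm (w Q - 1))" for Q
    proof -
      define c where "c = (\<lambda>n. complex_of_real (G n (m Q)))"
      define U where "U = (\<Sum>n<N Q. w Q ^ n * c n)"
      define e where "e = (\<lambda>i. \<Sum>n<N Q. w Q ^ (n + i) * c (n + i))"
      have cC: "norm (c n) \<le> C" for n using C by (simp add: c_def)
      have e1: "norm (e i - U) \<le> 2 * real M * C" if "i < M" for i
      proof -
        have "norm (e i - U) \<le> 2 * real i * C"
          unfolding e_def U_def by (rule exponential_sum_shift[OF w cC])
        also have "\<dots> \<le> 2 * real M * C" using that C0 by (intro mult_right_mono) auto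
        finally show ?thesis .
      qed
      have e2: "norm (\<Sum>i<M. w Q ^ (n + i) * c (n + i)) \<le> \<delta> / 2 * real M + real M * (real M * norm (w Q - 1) * C)" for n
      proof -
        have "(\<Sum>i<M. w Q ^ (n + i) * c (n + i)) = w Q ^ n * ((\<Sum>i<M. c (n + i)) + (\<Sum>i<M. (w Q ^ i - 1) * c (n + i)))"
          by (simp add: sum_distrib_left sum.distrib[symmetric] power_add algebra_simps)
        then have "norm (\<Sum>i<M. w Q ^ (n + i) * c (n + i)) \<le> norm (\<Sum>i<M. c (n + i)) + norm (\<Sum>i<M. (w Q ^ i - 1) * c (n + i))"
          using norm_triangle_ineq[of "\<Sum>i<M. c (n + i)" "\<Sum>i<M. (w Q ^ i - 1) * c (n + i)"] by (simp add: norm_mult norm_power w)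
        also have "norm (\<Sum>i<M. c (n + i)) \<le> \<delta> / 2 * real M"
          using M(2)[of n "m Q"] by (simp add: c_def flip: of_real_sum)
        also have "norm (\<Sum>i<M. (w Q ^ i - 1) * c (n + i)) \<le> (\<Sum>i<M. norm ((w Q ^ i - 1) * c (n + i)))"
          by (rule norm_sum)
        also have "\<dots> \<le> (\<Sum>i<M. real M * norm (w Q - 1) * C)"
        proof (intro sum_mono)
          fix i assume i: "i \<in> {..<M}"
          have "norm (w Q ^ i - 1) \<le> real i * norm (w Q - 1)" by (rule norm_power_diff_1_le[OF w])
          also have "\<dots> \<le> real M * norm (w Q - 1)" using i by (intro mult_right_mono) auto
          finally show "norm ((w Q ^ i - 1) * c (n + i)) \<le> real M * norm (w Q - 1) * C"
            unfolding norm_mult using cC by (intro mult_mono) auto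
        qed
        finally show ?thesis by simp
      qed
      have "of_nat M * U = (\<Sum>i<M. e i) - (\<Sum>i<M. e i - U)" by (simp add: sum_subtractf)
      then have "real M * norm U \<le> norm (\<Sum>i<M. e i) + norm (\<Sum>i<M. e i - U)"
        using norm_triangle_ineq4[of "\<Sum>i<M. e i" "\<Sum>i<M. e i - U"] by (metis norm_mult norm_of_nat)
      also have "norm (\<Sum>i<M. e i - U) \<le> (\<Sum>i<M. 2 * real M * C)"
        using e1 by (intro sum_norm_le) auto
      also have "(\<Sum>i<M. e i) = (\<Sum>n<N Q. \<Sum>i<M. w Q ^ (n + i) * c (n + i))"
        unfolding e_def by (rule sum.swap)
      also have "norm \<dots> \<le> (\<Sum>n<N Q. \<delta> / 2 * real M + real M * (real M * norm (w Q - 1) * C))"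
        using e2 by (intro sum_norm_le) auto
      finally have "real M * norm U \<le> real M * (real (N Q) * (\<delta> / 2 + real M * norm (w Q - 1) * C) + 2 * real M * C)"
        by (simp add: algebra_simps)
      then have "norm U \<le> real (N Q) * (\<delta> / 2 + real M * norm (w Q - 1) * C) + 2 * real M * C"
        using M(1) by simp
      moreover have "\<delta> * real (N Q) \<le> norm U" using big[of Q] by (simp add: U_def c_def)
      ultimately have "\<delta> * real (N Q) \<le> real (N Q) * (\<delta> / 2 + real M * norm (w Q - 1) * C) + 2 * real M * C"
        by linarith
      then show ?thesis using N0[of Q] by (simp add: field_simps)
    qed
    have "(\<lambda>Q. 2 * real M * C / real (N (r Q)) + (\<delta> / 2 + real M * C * norm (w (r Q) - 1))) \<longlonglongrightarrow>
        0 + (\<delta> / 2 + real M * C * norm (l - 1))"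
      by (intro tendsto_add[OF Ninf] tendsto_intros wl)
    then have "\<delta> \<le> 0 + (\<delta> / 2 + real M * C * norm (l - 1))"
      by (rule LIMSEQ_le_const) (use est in blast)
    then show False using \<delta> l1 by simp
  qed
  then show ?thesis using l(1) \<delta> bound by auto
qed

section \<open>A continuous eigenfunction\<close>

locale minimal_mpt = prob_space M for M :: "'a::metric_space measure" +
  fixes X :: "'a set" and f :: "'a \<Rightarrow> 'a"
  assumes compact_X: "compact X" and cont_f: "continuous_on X f" and f_onto: "f ` X = X"
    and minimal: "minimal_system X f"
    and sets_M: "sets M = sets (restrict_space borel X)"
    and f_meas: "f \<in> measurable M M" and f_inv: "distr M M f = M"
begin

lemma space_M: "space M = X"
  using sets_eq_imp_space_eq[OF sets_M] by (simp add: space_restrict_space)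

lemma prob_X: "prob X = 1"
  using prob_space by (simp add: space_M)

lemma X_nonempty: "X \<noteq> {}"
  using not_empty by (simp add: space_M)

lemma f_in: "x \<in> X \<Longrightarrow> f x \<in> X"
  using f_onto by blast

lemma iter_in: "x \<in> X \<Longrightarrow> (f ^^ n) x \<in> X"
  by (induction n) (auto intro: f_in)

lemma continuous_on_iter: "continuous_on X (f ^^ n)"
proof (induction n)
  case (Suc n)
  have "continuous_on X (f \<circ> (f ^^ n))"
    by (intro continuous_on_compose Suc continuous_on_subset[OF cont_f]) (auto intro: iter_in)
  then show ?case by simp
qed (simp add: continuous_on_id[unfolded id_def] id_def)

lemma open_sets_M: "openin (top_of_set X) U \<Longrightarrow> U \<in> sets M"
  unfolding openin_open sets_M by (auto simp: sets_restrict_space)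

lemma open_iter_preimage: "openin (top_of_set X) U \<Longrightarrow> openin (top_of_set X) (X \<inter> (f ^^ n) -` U)"
  using continuous_on_open_gen[of "f ^^ n" X X] continuous_on_iter iter_in by blast

lemma borel_measurable_continuous_on_X:
  "continuous_on X h \<Longrightarrow> h \<in> borel_measurable M" for h :: "'a \<Rightarrow> 'b::topological_space"
  using borel_measurable_continuous_on_restrict measurable_cong_sets[OF sets_M refl] by blast

lemma iter_meas: "(f ^^ n) \<in> measurable M M"
  by (induction n) (auto intro: measurable_comp[OF _ f_meas, unfolded comp_def] simp: comp_def)

lemma measure_preimage: "A \<in> sets M \<Longrightarrow> measure M (f -` A \<inter> X) = measure M A"
  using measure_distr[OF f_meas, of A] by (simp add: f_inv space_M)

lemma integral_iter:
  fixes h :: "'a \<Rightarrow> real"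
  assumes "h \<in> borel_measurable M"
  shows "(\<integral>x. h ((f ^^ n) x) \<partial>M) = (\<integral>x. h x \<partial>M)"
proof (induction n)
  case (Suc n)
  have "(\<lambda>x. h ((f ^^ n) x)) \<in> borel_measurable M"
    using measurable_compose[OF iter_meas assms] .
  then have "(\<integral>x. h ((f ^^ n) (f x)) \<partial>M) = (\<integral>x. h ((f ^^ n) x) \<partial>distr M M f)"
    by (intro integral_distr[symmetric] f_meas)
  then show ?case using Suc by (simp add: f_inv funpow_swap1)
qed simp

lemma orbit_near:
  assumes "x \<in> X" "openin (top_of_set X) U" "y \<in> U"
  shows "\<exists>n. (f ^^ n) x \<in> U"
proof -
  obtain T where T: "open T" "U = X \<inter> T" using assms(2) by (auto simp: openin_open)
  have "y \<in> closure {(f ^^ i) x |i. True}"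
    using minimal assms T unfolding minimal_system_def by blast
  then have "T \<inter> {(f ^^ i) x |i. True} \<noteq> {}"
    using T(1) T(2) assms(3) by (auto simp: closure_iff_nhds_not_empty)
  then show ?thesis using T(2) iter_in[OF assms(1)] by blast
qed

text \<open>By minimality the preimages of \<open>U\<close> under the iterates cover
  \<open>X\<close>. By invariance they all have the measure of \<open>U\<close>, so a null set
  \<open>U\<close> would make \<open>X\<close> null.\<close>

lemma measure_open_pos:
  assumes U: "openin (top_of_set X) U" "U \<noteq> {}"
  shows "0 < measure M U"
proof (rule ccontr)
  assume "\<not> 0 < measure M U"
  then have U0: "measure M U = 0" by (simp add: measure_nonneg order_antisym not_less)
  have pre: "X \<inter> (f ^^ n) -` U \<in> sets M" for n
    using open_sets_M[OF open_iter_preimage[OF U(1)]] .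
  have "measure M (X \<inter> (f ^^ n) -` U) = 0" for n
  proof (induction n)
    case 0
    have "X \<inter> U = U" using U(1) openin_imp_subset by blast
    then show ?case using U0 by simp
  next
    case (Suc n)
    have eq: "X \<inter> (f ^^ Suc n) -` U = f -` (X \<inter> (f ^^ n) -` U) \<inter> X"
      by (auto simp: funpow_swap1 f_in)
    show ?case unfolding eq by (rule trans[OF measure_preimage[OF pre] Suc])
  qed
  then have "emeasure M (\<Union>n. X \<inter> (f ^^ n) -` U) = 0"
    using pre by (subst emeasure_UN_eq_0) (auto simp: emeasure_eq_measure)
  moreover have "(\<Union>n. X \<inter> (f ^^ n) -` U) = X"
    using orbit_near[OF _ U(1)] U(2) by blast
  ultimately show False using emeasure_space_1 by (simp add: space_M)
qed

text \<open>The first hypothesis is lower semicontinuity in terms of sequences. The sublevel set at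
  height \<open>h x\<close> is closed and contains the dense orbit of \<open>x\<close>, so it is all
  of \<open>X\<close>; then exchange \<open>x\<close> and \<open>y\<close>.\<close>

lemma sublevel_constant:
  fixes h :: "'a \<Rightarrow> real"
  assumes closed: "\<And>c x s. x \<in> X \<Longrightarrow> (\<And>n. s n \<in> X) \<Longrightarrow> s \<longlonglongrightarrow> x \<Longrightarrow> (\<And>n. h (s n) \<le> c) \<Longrightarrow> h x \<le> c"
    and dec: "\<And>x. x \<in> X \<Longrightarrow> h (f x) \<le> h x"
    and "x \<in> X" "y \<in> X"
  shows "h x = h y"
proof -
  have "h y \<le> h x" if x: "x \<in> X" and y: "y \<in> X" for x y
  proof -
    have orb: "h ((f ^^ n) x) \<le> h x" for n
    proof (induction n)
      case (Suc n)
      then show ?case using dec[OF iter_in[OF x], of n] by simp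
    qed simp
    have "y \<in> closure {(f ^^ i) x |i. True}"
      using minimal x y unfolding minimal_system_def by blast
    then obtain s where s: "\<And>n. s n \<in> {(f ^^ i) x |i. True}" "s \<longlonglongrightarrow> y"
      unfolding closure_sequential by blast
    show ?thesis
    proof (rule closed[OF y _ s(2)])
      show "s n \<in> X" for n using s(1)[of n] iter_in[OF x] by auto
      show "h (s n) \<le> h x" for n using s(1)[of n] orb by auto
    qed
  qed
  then show ?thesis using assms(3,4) by (meson order_antisym)
qed

text \<open>The sections of the union of the preimages of \<open>V1 \<times> V2\<close> under the positive iterates of
  \<open>f \<times> f\<close>, an open and backward invariant subset of \<open>X \<times> X\<close>.\<close>
definition sec :: "'a set \<Rightarrow> 'a set \<Rightarrow> 'a \<Rightarrow> 'a set" where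
  "sec V1 V2 x = {y \<in> X. \<exists>k\<ge>1. (f ^^ k) x \<in> V1 \<and> (f ^^ k) y \<in> V2}"

lemma sec_subset: "sec V1 V2 x \<subseteq> X"
  by (auto simp: sec_def)

lemma openin_sec:
  assumes "openin (top_of_set X) V2"
  shows "openin (top_of_set X) (sec V1 V2 x)"
proof -
  have eq: "sec V1 V2 x = (\<Union>k\<in>{k. k \<ge> 1 \<and> (f ^^ k) x \<in> V1}. X \<inter> (f ^^ k) -` V2)"
    by (auto simp: sec_def)
  show ?thesis unfolding eq using open_iter_preimage[OF assms] by (intro openin_Union) blast
qed

lemma sec_meas: "openin (top_of_set X) V2 \<Longrightarrow> sec V1 V2 x \<in> sets M"
  by (intro open_sets_M openin_sec)

lemma sec_preimage_subset: "f -` sec V1 V2 (f x) \<inter> X \<subseteq> sec V1 V2 x"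
proof
  fix y assume y: "y \<in> f -` sec V1 V2 (f x) \<inter> X"
  then obtain k where "k \<ge> 1" "(f ^^ k) (f x) \<in> V1" "(f ^^ k) (f y) \<in> V2" by (auto simp: sec_def)
  then have "Suc k \<ge> 1 \<and> (f ^^ Suc k) x \<in> V1 \<and> (f ^^ Suc k) y \<in> V2" by (simp add: funpow_swap1)
  then show "y \<in> sec V1 V2 x" using y unfolding sec_def by blast
qed

text \<open>A point of the section over \<open>x\<close> belongs to the sections over all nearby
  points, because a single time \<open>k\<close> witnesses membership and \<open>V1\<close> is open.
  Dominated convergence does the rest. This yields lower semicontinuity of the measure, and later
  continuity of the kernel.\<close>

lemma sec_limit:
  assumes V: "openin (top_of_set X) V1" "openin (top_of_set X) V2"
    and x: "x \<in> X" "\<And>n. s n \<in> X" "s \<longlonglongrightarrow> x"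
  shows "(\<lambda>n. measure M (sec V1 V2 (s n) \<inter> sec V1 V2 x)) \<longlonglongrightarrow> measure M (sec V1 V2 x)"
proof -
  note sm = sec_meas[OF V(2)]
  have "(\<lambda>n. \<integral>y. indicat_real (sec V1 V2 (s n) \<inter> sec V1 V2 x) y \<partial>M) \<longlonglongrightarrow> (\<integral>y. indicat_real (sec V1 V2 x) y \<partial>M)"
  proof (rule integral_dominated_convergence[where w = "\<lambda>_. 1"])
    show "AE y in M. (\<lambda>n. indicat_real (sec V1 V2 (s n) \<inter> sec V1 V2 x) y) \<longlonglongrightarrow> indicat_real (sec V1 V2 x) y"
    proof (rule AE_I2)
      fix y
      show "(\<lambda>n. indicat_real (sec V1 V2 (s n) \<inter> sec V1 V2 x) y) \<longlonglongrightarrow> indicat_real (sec V1 V2 x) y"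
      proof (cases "y \<in> sec V1 V2 x")
        case True
        then obtain k where k: "k \<ge> 1" "(f ^^ k) x \<in> V1" "(f ^^ k) y \<in> V2" "y \<in> X" by (auto simp: sec_def)
        obtain T where T: "open T" "V1 = X \<inter> T" using V(1) by (auto simp: openin_open)
        have "(\<lambda>n. (f ^^ k) (s n)) \<longlonglongrightarrow> (f ^^ k) x"
          using continuous_on_tendsto_compose[OF continuous_on_iter x(3) x(1)] x(2) by auto
        then have "\<forall>\<^sub>F n in sequentially. (f ^^ k) (s n) \<in> T"
          using k T by (intro topological_tendstoD) auto
        then have "\<forall>\<^sub>F n in sequentially. indicat_real (sec V1 V2 (s n) \<inter> sec V1 V2 x) y = indicat_real (sec V1 V2 x) y"
          by eventually_elim (use k T x iter_in True in \<open>auto simp: sec_def indicator_def\<close>)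
        then show ?thesis by (rule tendsto_eventually)
      qed (simp add: indicator_def)
    qed
    show "AE y in M. norm (indicat_real (sec V1 V2 (s n) \<inter> sec V1 V2 x) y) \<le> 1" for n
      by (auto simp: indicator_def)
  qed (use sm in auto)
  then show ?thesis using sm by (simp add: space_M Int_absorb2 sec_subset le_infI1)
qed

text \<open>This is \<open>sublevel_constant\<close> for the measure of the section:
  \<open>sec_limit\<close> gives semicontinuity, and \<open>sec_preimage_subset\<close> with
  invariance gives monotonicity along orbits.\<close>

lemma measure_sec_constant:
  assumes V: "openin (top_of_set X) V1" "openin (top_of_set X) V2" and "x \<in> X" "y \<in> X"
  shows "measure M (sec V1 V2 x) = measure M (sec V1 V2 y)"
proof (rule sublevel_constant[OF _ _ assms(3,4)])
  note sm = sec_meas[OF V(2)]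
  fix x assume x: "x \<in> X"
  have "measure M (sec V1 V2 (f x)) = measure M (f -` sec V1 V2 (f x) \<inter> X)"
    by (rule measure_preimage[OF sm, symmetric])
  also have "\<dots> \<le> measure M (sec V1 V2 x)"
    using sm by (intro finite_measure_mono sec_preimage_subset)
  finally show "measure M (sec V1 V2 (f x)) \<le> measure M (sec V1 V2 x)" .
  fix c s assume s: "\<And>n. s n \<in> X" "s \<longlonglongrightarrow> x" "\<And>n. measure M (sec V1 V2 (s n)) \<le> c"
  have "measure M (sec V1 V2 (s n) \<inter> sec V1 V2 x) \<le> c" for n
    using s(3)[of n] finite_measure_mono[of "sec V1 V2 (s n) \<inter> sec V1 V2 x" "sec V1 V2 (s n)"] sm by fastforce
  then show "measure M (sec V1 V2 x) \<le> c"
    using LIMSEQ_le_const2[OF sec_limit[OF V x s(1,2)]] by blast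
qed

end

section \<open>The invariant kernel of a system that is not weakly mixing\<close>

locale non_mixing_mpt = minimal_mpt +
  fixes U1 U2 V1 V2 :: "'a set"
  assumes V: "openin (top_of_set X) V1" "openin (top_of_set X) V2" "V1 \<noteq> {}" "V2 \<noteq> {}"
    and U: "openin (top_of_set X) U1" "openin (top_of_set X) U2" "U1 \<noteq> {}" "U2 \<noteq> {}"
    and separated: "\<And>k x y. k \<ge> 1 \<Longrightarrow> x \<in> U1 \<Longrightarrow> y \<in> U2 \<Longrightarrow> (f ^^ k) x \<in> V1 \<Longrightarrow> (f ^^ k) y \<in> V2 \<Longrightarrow> False"
begin

abbreviation W :: "'a \<Rightarrow> 'a set" where "W \<equiv> sec V1 V2"

definition c :: real where "c = measure M (W (SOME x. x \<in> X))"

lemma measure_W: "x \<in> X \<Longrightarrow> measure M (W x) = c"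
  unfolding c_def using measure_sec_constant[OF V(1,2)] X_nonempty by (metis some_in_eq)

lemmas W_meas [measurable] = sec_meas[OF V(2)]

text \<open>For positivity, take preimages of points of \<open>V1\<close> and \<open>V2\<close>
  under \<open>f\<close>: they are related at time 1, so some section is a nonempty open set. For
  the upper bound, the section over a point of \<open>U1\<close> misses \<open>U2\<close>, which has
  positive measure.\<close>

lemma c_bounds: "0 < c" "c < 1"
proof -
  obtain v1 v2 where v: "v1 \<in> V1" "v2 \<in> V2" using V by blast
  then have "v1 \<in> X" "v2 \<in> X" using V openin_imp_subset by blast+
  then have "v1 \<in> f ` X" "v2 \<in> f ` X" unfolding f_onto .
  then obtain x y where xy: "x \<in> X" "v1 = f x" "y \<in> X" "v2 = f y" by (elim imageE)
  then have "y \<in> W x" using v unfolding sec_def by (auto intro!: exI[of _ 1])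
  then have "0 < measure M (W x)"
    by (intro measure_open_pos openin_sec V) auto
  then show "0 < c" using measure_W xy by simp
  obtain u where u: "u \<in> U1" using U by blast
  have "u \<in> X" using u U openin_imp_subset by blast
  have "y \<notin> U2" if "y \<in> W u" for y
    using that separated[OF _ u] by (auto simp: sec_def)
  then have "W u \<inter> U2 = {}" by blast
  then have "measure M (W u \<union> U2) = measure M (W u) + measure M U2"
    using open_sets_M U W_meas by (intro finite_measure_Union) auto
  then show "c < 1"
    using measure_open_pos[OF U(2,4)] prob_le_1[of "W u \<union> U2"] measure_W[OF \<open>u \<in> X\<close>] by simp
qed

text \<open>On \<open>X\<close> this is the covariance of the indicators of two sections. As all
  sections have measure \<open>c\<close>, the difference \<open>b - K x y\<close> is the measure of
  \<open>W x - W y\<close>, half the measure of the symmetric difference; it serves as an invariant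
  pseudometric.\<close>

definition K :: "'a \<Rightarrow> 'a \<Rightarrow> real" where
  "K x y = measure M (W x \<inter> W y) - c * c"

definition b :: real where "b = c - c * c"

lemma b_pos: "b > 0"
  using c_bounds mult_strict_right_mono[of c 1 c] by (simp add: b_def)

lemma K_sym: "K x y = K y x"
  by (simp add: K_def Int_commute)

lemma K_diag: "x \<in> X \<Longrightarrow> K x x = b"
  by (simp add: K_def b_def measure_W)

lemma K_bound: "\<bar>K x y\<bar> \<le> 1"
proof -
  have "c * c \<le> 1" using c_bounds mult_mono[of c 1 c 1] by simp
  moreover have "0 \<le> c * c" by simp
  ultimately show ?thesis unfolding K_def
    using measure_nonneg[of M "W x \<inter> W y"] prob_le_1[of "W x \<inter> W y"] by linarith
qed

lemma K_inv:
  assumes "x \<in> X" "y \<in> X"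
  shows "K (f x) (f y) = K x y"
proof -
  \<comment> \<open>The preimage of \<open>W (f x)\<close> lies in \<open>W x\<close> and both have
    measure \<open>c\<close>, so they differ by a null set.\<close>
  have ae: "AE z in M. z \<in> W x \<longleftrightarrow> f z \<in> W (f x)" if x: "x \<in> X" for x
  proof -
    have pm: "f -` W (f x) \<inter> X \<in> sets M"
      using measurable_sets[OF f_meas W_meas] by (simp add: space_M)
    have "measure M (W x - (f -` W (f x) \<inter> X)) = measure M (W x) - measure M (f -` W (f x) \<inter> X)"
      using pm by (intro finite_measure_Diff sec_preimage_subset) auto
    also have "\<dots> = 0" using measure_preimage[OF W_meas] measure_W x f_in by simp
    finally have "W x - (f -` W (f x) \<inter> X) \<in> null_sets M"
      using pm by (intro null_setsI) (auto simp: emeasure_eq_measure)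
    then have "AE z in M. z \<notin> W x - (f -` W (f x) \<inter> X)" by (rule AE_not_in)
    with AE_space show ?thesis
      by eventually_elim (use sec_preimage_subset[of V1 V2 x] in \<open>auto simp: space_M\<close>)
  qed
  have "measure M (W (f x) \<inter> W (f y)) = measure M (f -` (W (f x) \<inter> W (f y)) \<inter> X)"
    by (rule measure_preimage[symmetric]) auto
  also have "\<dots> = measure M (W x \<inter> W y)"
  proof (rule measure_eq_AE)
    show "AE z in M. z \<in> f -` (W (f x) \<inter> W (f y)) \<inter> X \<longleftrightarrow> z \<in> W x \<inter> W y"
      using ae[OF assms(1)] ae[OF assms(2)] AE_space by eventually_elim (auto simp: space_M)
    show "f -` (W (f x) \<inter> W (f y)) \<inter> X \<in> sets M"
      using measurable_sets[OF f_meas, of "W (f x) \<inter> W (f y)"] by (simp add: space_M)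
  qed auto
  finally show ?thesis by (simp add: K_def)
qed

lemma K_inv_iter: "x \<in> X \<Longrightarrow> y \<in> X \<Longrightarrow> K ((f ^^ n) x) ((f ^^ n) y) = K x y"
  by (induction n) (auto simp: K_inv iter_in)

lemma K_lip:
  assumes "x \<in> X" "x' \<in> X"
  shows "\<bar>K x y - K x' y\<bar> \<le> b - K x x'"
proof -
  have *: "K x y - K x' y \<le> b - K x x'" if "x \<in> X" for x x'
  proof -
    have "measure M (W x \<inter> W y) \<le> measure M ((W x' \<inter> W y) \<union> (W x - W x'))"
      by (intro finite_measure_mono) auto
    also have "\<dots> \<le> measure M (W x' \<inter> W y) + measure M (W x - W x')"
      by (intro measure_Un_le) auto
    also have "measure M (W x - W x') = c - measure M (W x \<inter> W x')"
      using measure_W[OF that] by (subst finite_measure_Diff') auto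
    finally show ?thesis by (simp add: K_def b_def)
  qed
  from *[OF assms(1), of x'] *[OF assms(2), of x] show ?thesis by (simp add: K_sym)
qed

lemma K_triangle:
  assumes "x \<in> X" "y \<in> X"
  shows "b - K x z \<le> (b - K x y) + (b - K y z)"
  using K_lip[OF assms, of z] by linarith

lemma K_tendsto:
  assumes "x \<in> X" "\<And>n. s n \<in> X" "s \<longlonglongrightarrow> x"
  shows "(\<lambda>n. K (s n) x) \<longlonglongrightarrow> b"
  unfolding K_def b_def measure_W[OF assms(1), symmetric]
  by (intro tendsto_diff sec_limit V assms tendsto_const)

text \<open>\<open>K_lip\<close> reduces continuity at \<open>x\<close> to convergence of
  \<open>K (s n) x\<close> to the diagonal value \<open>b\<close>, which is
  \<open>K_tendsto\<close>.\<close>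

lemma K_continuous: "continuous_on X (\<lambda>x. K x y)"
  unfolding continuous_on_sequentially
proof (intro allI ballI impI)
  fix s x assume s: "x \<in> X" "(\<forall>n. s n \<in> X) \<and> s \<longlonglongrightarrow> x"
  have "(\<lambda>n. b - K (s n) x) \<longlonglongrightarrow> b - b"
    using s by (intro tendsto_intros K_tendsto) auto
  then have "(\<lambda>n. b - K (s n) x) \<longlonglongrightarrow> 0" by simp
  then have "(\<lambda>n. K (s n) y - K x y) \<longlonglongrightarrow> 0"
    by (rule Lim_null_comparison[rotated]) (use s K_lip in \<open>auto intro!: always_eventually\<close>)
  then show "((\<lambda>x. K x y) \<circ> s) \<longlonglongrightarrow> K x y"
    by (simp add: o_def LIM_zero_iff)
qed

lemma K_meas [measurable]: "(\<lambda>x. K x y) \<in> borel_measurable M"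
  by (intro borel_measurable_continuous_on_X K_continuous)

text \<open>Fubini: the sections in the other direction are of the same kind with \<open>V1\<close>
  and \<open>V2\<close> exchanged, so their measure is constant too.\<close>

lemma K_mean_0:
  assumes y: "y \<in> X"
  shows "(\<integral>x. K x y \<partial>M) = 0"
proof -
  interpret MM: pair_sigma_finite M M
    by unfold_locales
  \<comment> \<open>\<open>Q B\<close> is the part of the backward invariant open set whose second
    coordinate lies in \<open>B\<close>, written as a countable union of measurable
    rectangles.\<close>
  define Q where "Q = (\<lambda>B. \<Union>k\<in>{1::nat..}. (X \<inter> (f ^^ k) -` V1) \<times> (X \<inter> (f ^^ k) -` V2 \<inter> B))"
  define c' where "c' = measure M (sec V2 V1 y)"
  have pre: "X \<inter> (f ^^ k) -` V1 \<in> sets M" "X \<inter> (f ^^ k) -` V2 \<in> sets M" for k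
    using open_sets_M open_iter_preimage V by blast+
  have Q_meas: "Q B \<in> sets (M \<Otimes>\<^sub>M M)" if "B \<in> sets M" for B
    unfolding Q_def by (intro sets.countable_UN'' pair_measureI sets.Int pre that) simp
  have row: "Pair x -` Q B = W x \<inter> B" if "x \<in> X" for x B
    using that by (auto simp: Q_def sec_def)
  have col: "(\<lambda>x. (x, z)) -` Q B = (if z \<in> B then sec V2 V1 z else {})" if "z \<in> X" for z B
    using that by (auto simp: Q_def sec_def)
  have fub: "(\<integral>\<^sup>+x. emeasure M (W x \<inter> B) \<partial>M) = ennreal c' * emeasure M B" if B: "B \<in> sets M" for B
  proof -
    have "(\<integral>\<^sup>+x. emeasure M (W x \<inter> B) \<partial>M) = (\<integral>\<^sup>+x. emeasure M (Pair x -` Q B) \<partial>M)"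
      by (intro nn_integral_cong) (simp add: row space_M)
    also have "\<dots> = (\<integral>\<^sup>+z. emeasure M ((\<lambda>x. (x, z)) -` Q B) \<partial>M)"
      using Q_meas[OF B] by (simp add: emeasure_pair_measure_alt[symmetric] MM.emeasure_pair_measure_alt2)
    also have "\<dots> = (\<integral>\<^sup>+z. ennreal c' * indicator B z \<partial>M)"
      using measure_sec_constant[OF V(2,1) _ y]
      by (intro nn_integral_cong) (auto simp: col space_M c'_def emeasure_eq_measure indicator_def)
    also have "\<dots> = ennreal c' * emeasure M B"
      using B by (rule nn_integral_cmult_indicator)
    finally show ?thesis .
  qed
  have "(\<integral>\<^sup>+x. emeasure M (W x \<inter> X) \<partial>M) = (\<integral>\<^sup>+x. ennreal c \<partial>M)"
    by (intro nn_integral_cong) (simp add: space_M emeasure_eq_measure measure_W Int_absorb2 sec_subset)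
  \<comment> \<open>\<open>B = X\<close> identifies the constant \<open>c'\<close> of the exchanged
    sections with \<open>c\<close>; after that, \<open>B = W y\<close> gives the mean
    \<open>c * c\<close>.\<close>
  then have "ennreal c = ennreal c'"
    using fub[of X] emeasure_space_1 sets.top[of M] by (simp add: space_M)
  then have "c' = c" using c_bounds(1) by (simp add: c'_def measure_nonneg)
  then have *: "(\<integral>\<^sup>+x. ennreal (measure M (W x \<inter> W y)) \<partial>M) = ennreal (c * c)"
    using fub[of "W y"] W_meas c_bounds(1) measure_W[OF y]
    by (simp add: emeasure_eq_measure ennreal_mult)
  have eq: "measure M (W x \<inter> W y) = K x y + c * c" for x by (simp add: K_def)
  have "(\<lambda>x. K x y + c * c) \<in> borel_measurable M" by measurable
  then have "(\<integral>x. K x y + c * c \<partial>M) = enn2real (ennreal (c * c))"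
    unfolding *[symmetric] eq[symmetric] by (intro integral_eq_nn_integral) auto
  then have "(\<integral>x. K x y + c * c \<partial>M) = c * c"
    using c_bounds(1) by simp
  moreover have "integrable M (\<lambda>x. K x y)"
    by (rule integrable_const_bound[of _ 1]) (use K_bound in auto)
  ultimately show ?thesis by (simp add: prob_space)
qed

text \<open>The values of \<open>K\<close> form the Gram matrix of the centred indicators
  \<open>v n\<close>, so the double sum is the integral of a squared modulus.\<close>

lemma K_psd:
  fixes w :: complex and s :: "nat \<Rightarrow> 'a"
  assumes s: "\<And>n. s n \<in> X"
  shows "0 \<le> Re (\<Sum>n<N. \<Sum>m<N. w ^ n * cnj w ^ m * of_real (K (s n) (s m)))"
proof -
  define v where "v = (\<lambda>n z. indicat_real (W (s n)) z - c)"
  have v_meas [measurable]: "v n \<in> borel_measurable M" for n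
    unfolding v_def by measurable
  have v_bound: "\<bar>v n z\<bar> \<le> 1" for n z
    using c_bounds by (auto simp: v_def indicator_def)
  have int_vv: "integrable M (\<lambda>z. v n z * v m z)" for n m
    by (rule integrable_const_bound[of _ 1])
      (use v_bound in \<open>auto simp: abs_mult intro!: mult_le_one\<close>)
  have K_eq: "K (s n) (s m) = (\<integral>z. v n z * v m z \<partial>M)" for n m
  proof -
    have "v n z * v m z = indicat_real (W (s n) \<inter> W (s m)) z - c * indicat_real (W (s n)) z
        - c * indicat_real (W (s m)) z + c * c" for z
      by (simp add: v_def indicator_inter_arith algebra_simps)
    then have "(\<integral>z. v n z * v m z \<partial>M) = measure M (W (s n) \<inter> W (s m)) - c * measure M (W (s n))
        - c * measure M (W (s m)) + c * c"
      by (simp add: prob_X space_M Int_absorb2 sec_subset le_infI1 emeasure_eq_measure)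
    then show ?thesis by (simp add: measure_W s K_def)
  qed
  have "(\<Sum>n<N. \<Sum>m<N. w ^ n * cnj w ^ m * complex_of_real (K (s n) (s m))) =
      (\<integral>z. (\<Sum>n<N. \<Sum>m<N. w ^ n * cnj w ^ m * complex_of_real (v n z * v m z)) \<partial>M)"
  proof -
    have ic: "integrable M (\<lambda>z. w ^ n * cnj w ^ m * complex_of_real (v n z * v m z))" for n m
      by (intro integrable_mult_right integrable_of_real int_vv)
    have "(\<integral>z. (\<Sum>n<N. \<Sum>m<N. w ^ n * cnj w ^ m * complex_of_real (v n z * v m z)) \<partial>M) =
        (\<Sum>n<N. \<Sum>m<N. \<integral>z. w ^ n * cnj w ^ m * complex_of_real (v n z * v m z) \<partial>M)"
      by (subst Bochner_Integration.integral_sum, intro Bochner_Integration.integrable_sum ic)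
        (intro sum.cong refl Bochner_Integration.integral_sum ic)
    also have "\<dots> = (\<Sum>n<N. \<Sum>m<N. w ^ n * cnj w ^ m * complex_of_real (K (s n) (s m)))"
      unfolding K_eq by (simp only: integral_mult_right_zero integral_complex_of_real)
    finally show ?thesis by (rule sym)
  qed
  also have "(\<lambda>z. \<Sum>n<N. \<Sum>m<N. w ^ n * cnj w ^ m * complex_of_real (v n z * v m z)) =
      (\<lambda>z. complex_of_real ((norm (\<Sum>n<N. w ^ n * complex_of_real (v n z)))\<^sup>2))"
    unfolding complex_norm_square cnj_sum sum_product
    by (intro ext sum.cong refl) (simp add: mult_ac)
  also have "(\<integral>z. complex_of_real ((norm (\<Sum>n<N. w ^ n * complex_of_real (v n z)))\<^sup>2) \<partial>M) =
      complex_of_real (\<integral>z. (norm (\<Sum>n<N. w ^ n * complex_of_real (v n z)))\<^sup>2 \<partial>M)"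
    by (rule integral_complex_of_real)
  finally show ?thesis by simp
qed

text \<open>Minimality gives a return time for each pair of points; compactness of
  \<open>X \<times> X\<close> and continuity of the kernel bound it uniformly.\<close>

lemma uniform_recurrence:
  assumes e: "e > 0"
  shows "\<exists>L. \<forall>x\<in>X. \<forall>y\<in>X. \<exists>k<L. b - K ((f ^^ k) x) y < e"
proof (rule ccontr)
  assume "\<not> ?thesis"
  then have "\<forall>L. \<exists>x y. x \<in> X \<and> y \<in> X \<and> (\<forall>k<L. b - K ((f ^^ k) x) y \<ge> e)"
    by (meson not_le)
  then obtain s t where st: "\<And>L. s L \<in> X" "\<And>L. t L \<in> X" "\<And>L k. k < L \<Longrightarrow> b - K ((f ^^ k) (s L)) (t L) \<ge> e"
    by metis
  have "seq_compact (X \<times> X)" using compact_X by (simp add: compact_Times compact_imp_seq_compact)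
  moreover have "\<forall>L. (s L, t L) \<in> X \<times> X" using st(1,2) by blast
  ultimately obtain p r where p: "p \<in> X \<times> X" "strict_mono r" "((\<lambda>L. (s L, t L)) \<circ> r) \<longlonglongrightarrow> p"
    by (rule seq_compactE)
  obtain x y where xy: "p = (x, y)" "x \<in> X" "y \<in> X" using p(1) by blast
  have lim: "(\<lambda>L. s (r L)) \<longlonglongrightarrow> x" "(\<lambda>L. t (r L)) \<longlonglongrightarrow> y"
    using tendsto_fst[OF p(3)] tendsto_snd[OF p(3)] by (auto simp: xy o_def)
  have "openin (top_of_set X) {z \<in> X. K z y > b - e / 2}"
    using continuous_openin_preimage_gen[OF K_continuous[of y] open_greaterThan[of "b - e / 2"]]
    by (simp add: vimage_def Int_def)
  moreover have "y \<in> {z \<in> X. K z y > b - e / 2}" using xy K_diag e by simp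
  ultimately obtain k where k: "K ((f ^^ k) x) y > b - e / 2"
    using orbit_near[OF xy(2)] by blast
  have "(\<lambda>L. (b - K (s (r L)) x) + (b - K ((f ^^ k) x) y) + (b - K (t (r L)) y)) \<longlonglongrightarrow>
      (b - b) + (b - K ((f ^^ k) x) y) + (b - b)"
    using st by (intro tendsto_intros K_tendsto xy lim) auto
  moreover have "e \<le> (b - K (s (r L)) x) + (b - K ((f ^^ k) x) y) + (b - K (t (r L)) y)" if "L \<ge> Suc k" for L
  proof -
    have "k < r L" using seq_suble[OF p(2), of L] that by linarith
    \<comment> \<open>Two triangle inequalities pass through \<open>(f ^^ k) x\<close> and
      \<open>y\<close>; invariance turns the first distance at time \<open>k\<close> into one at
      time 0, which tends to 0.\<close>
    then have "e \<le> b - K ((f ^^ k) (s (r L))) (t (r L))" by (rule st(3))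
    also have "\<dots> \<le> (b - K ((f ^^ k) (s (r L))) ((f ^^ k) x)) + (b - K ((f ^^ k) x) (t (r L)))"
      using st xy by (intro K_triangle iter_in) auto
    also have "K ((f ^^ k) (s (r L))) ((f ^^ k) x) = K (s (r L)) x"
      using st xy by (intro K_inv_iter) auto
    also have "b - K ((f ^^ k) x) (t (r L)) \<le> (b - K ((f ^^ k) x) y) + (b - K y (t (r L)))"
      using st xy by (intro K_triangle iter_in) auto
    finally show ?thesis by (simp add: K_sym[of y])
  qed
  ultimately have "e \<le> (b - b) + (b - K ((f ^^ k) x) y) + (b - b)"
    by (intro LIMSEQ_le_const) auto
  then show False using k e by simp
qed

text \<open>Orbits come uniformly close to every point in bounded time, so the Birkhoff sums of the
  equicontinuous functions \<open>K _ y\<close> are asymptotically constant, and their integrals vanish.\<close>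
lemma uniform_average:
  assumes e: "e > 0"
  shows "\<exists>R\<ge>1. \<forall>x\<in>X. \<forall>y\<in>X. \<bar>\<Sum>i<R. K ((f ^^ i) x) y\<bar> \<le> e * real R"
proof -
  obtain L where L: "\<And>x y. x \<in> X \<Longrightarrow> y \<in> X \<Longrightarrow> \<exists>k<L. b - K ((f ^^ k) x) y < e / 2"
    using uniform_recurrence[of "e / 2"] e by (auto simp: Ball_def)
  \<comment> \<open>\<open>R\<close> is large enough that the shift error \<open>2 * L\<close> is at
    most half of \<open>e * R\<close>; the other half pays for comparing the two orbits.\<close>
  define R where "R = Suc (nat \<lceil>4 * real L / e\<rceil>)"
  have "4 * real L / e \<le> real R" unfolding R_def by linarith
  then have R: "4 * real L \<le> e * real R" using e by (simp add: field_simps)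
  define A where "A = (\<lambda>y x. \<Sum>i<R. K ((f ^^ i) x) y)"
  have close: "\<bar>A y x - A y z\<bar> \<le> e * real R" if xyz: "x \<in> X" "y \<in> X" "z \<in> X" for x y z
  proof -
    obtain k where k: "k < L" "b - K ((f ^^ k) x) z < e / 2" using L xyz by blast
    \<comment> \<open>The shift estimate for exponential sums is applied with the trivial frequency
      1.\<close>
    have "norm ((\<Sum>i<R. 1 ^ (i + k) * complex_of_real (K ((f ^^ (i + k)) x) y))
        - (\<Sum>i<R. 1 ^ i * complex_of_real (K ((f ^^ i) x) y))) \<le> 2 * real k * 1"
      by (rule exponential_sum_shift) (use K_bound in auto)
    then have "norm (complex_of_real (A y ((f ^^ k) x) - A y x)) \<le> 2 * real k"
      by (simp add: A_def funpow_add)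
    then have 1: "\<bar>A y ((f ^^ k) x) - A y x\<bar> \<le> 2 * real L" using k(1) by (simp only: norm_of_real)
    have "\<bar>A y ((f ^^ k) x) - A y z\<bar> \<le> (\<Sum>i<R. \<bar>K ((f ^^ i) ((f ^^ k) x)) y - K ((f ^^ i) z) y\<bar>)"
      unfolding A_def sum_subtractf[symmetric] by (rule sum_abs)
    also have "\<dots> \<le> (\<Sum>i<R. e / 2)"
    proof (intro sum_mono)
      fix i
      have "\<bar>K ((f ^^ i) ((f ^^ k) x)) y - K ((f ^^ i) z) y\<bar> \<le> b - K ((f ^^ i) ((f ^^ k) x)) ((f ^^ i) z)"
        using xyz by (intro K_lip iter_in)
      also have "\<dots> = b - K ((f ^^ k) x) z" using xyz by (simp add: K_inv_iter iter_in)
      finally show "\<bar>K ((f ^^ i) ((f ^^ k) x)) y - K ((f ^^ i) z) y\<bar> \<le> e / 2" using k(2) by linarith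
    qed
    finally have "\<bar>A y ((f ^^ k) x) - A y z\<bar> \<le> (e * real R) / 2" by (simp add: mult.commute)
    with 1 R show ?thesis by linarith
  qed
  have "\<bar>A y x\<bar> \<le> e * real R" if xy: "x \<in> X" "y \<in> X" for x y
  proof -
    have it_meas [measurable]: "(\<lambda>z. K ((f ^^ i) z) y) \<in> borel_measurable M" for i
      using measurable_compose[OF iter_meas K_meas] .
    have int_it: "integrable M (\<lambda>z. K ((f ^^ i) z) y)" for i
      by (rule integrable_const_bound[of _ 1]) (use K_bound in auto)
    have int_A: "integrable M (A y)" unfolding A_def using int_it by auto
    have "(\<integral>z. A y z \<partial>M) = 0"
      unfolding A_def using int_it by (simp add: integral_iter[OF K_meas] K_mean_0 xy)
    then have "A y x = (\<integral>z. A y x - A y z \<partial>M)"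
      using int_A by (simp add: prob_space)
    also have "\<bar>\<dots>\<bar> \<le> (\<integral>z. \<bar>A y x - A y z\<bar> \<partial>M)"
      using integral_norm_bound[of M "\<lambda>z. A y x - A y z"] by simp
    also have "\<dots> \<le> (\<integral>z. e * real R \<partial>M)"
      using int_A close xy by (intro integral_mono) (auto simp: space_M)
    finally show ?thesis by (simp add: prob_space)
  qed
  then show ?thesis unfolding A_def by (intro exI[of _ R]) (auto simp: R_def)
qed

lemma ex_eigenvalue_along_orbit:
  assumes x: "x \<in> X"
  shows "\<exists>(l::complex) \<delta>. norm l = 1 \<and> l \<noteq> 1 \<and> \<delta> > 0 \<and> (\<forall>j. \<delta> * norm (l ^ j - 1) \<le> b - K ((f ^^ j) x) x)"
proof -
  define G where "G = (\<lambda>n m. K ((f ^^ n) x) ((f ^^ m) x))"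
  obtain L where L: "\<And>x y. x \<in> X \<Longrightarrow> y \<in> X \<Longrightarrow> \<exists>k<L. b - K ((f ^^ k) x) y < b / 2"
    using uniform_recurrence[of "b / 2"] b_pos by (auto simp: Ball_def)
  have it: "(f ^^ (n + k)) x = (f ^^ k) ((f ^^ n) x)" for n k
    by (simp add: add.commute[of n] funpow_add)
  have "\<exists>(l::complex) \<delta>. norm l = 1 \<and> l \<noteq> 1 \<and> \<delta> > 0 \<and> (\<forall>j. \<delta> * norm (l ^ j - 1) \<le> b - G j 0)"
  proof (rule ex_eigenvalue[where C = 1])
    show "G n m = G m n" for n m by (simp add: G_def K_sym)
    show "G (Suc n) (Suc m) = G n m" for n m using x by (simp add: G_def K_inv iter_in)
    show "G 0 0 = b" using x by (simp add: G_def K_diag)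
    show "0 \<le> Re (\<Sum>n<N. \<Sum>m<N. w ^ n * cnj w ^ m * of_real (G n m))" for N and w :: complex
      unfolding G_def using x by (intro K_psd iter_in)
    show "\<exists>k<L. b / 2 \<le> G (n + k) m" for n m
      using L[OF iter_in[OF x] iter_in[OF x], of n m] unfolding G_def it by fastforce
    show "\<bar>G n m\<bar> \<le> 1" for n m unfolding G_def by (rule K_bound)
    show "\<bar>G (n + j) m - G n m\<bar> \<le> b - G j 0" for n m j
    proof -
      have "\<bar>G (n + j) m - G n m\<bar> \<le> b - K ((f ^^ (n + j)) x) ((f ^^ n) x)"
        unfolding G_def using x by (intro K_lip iter_in)
      also have "(f ^^ (n + j)) x = (f ^^ n) ((f ^^ j) x)" by (simp add: funpow_add)
      also have "b - K ((f ^^ n) ((f ^^ j) x)) ((f ^^ n) x) = b - G j 0"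
        using x by (simp add: K_inv_iter iter_in G_def)
      finally show ?thesis .
    qed
    show "\<exists>R\<ge>1. \<forall>n m. \<bar>\<Sum>i<R. G (n + i) m\<bar> \<le> e * real R" if "e > 0" for e
      using uniform_average[OF that] iter_in[OF x] unfolding G_def it by blast
  qed (rule b_pos)
  then show ?thesis by (simp add: G_def)
qed

text \<open>If this failed, two sequences with distance tending to 0 would have a common limit
  point, and the triangle inequality through it would contradict \<open>K_tendsto\<close>.\<close>

lemma K_uniformly_continuous:
  assumes e: "e > 0"
  shows "\<exists>d>0. \<forall>x\<in>X. \<forall>y\<in>X. dist x y < d \<longrightarrow> b - K x y < e"
proof (rule ccontr)
  assume "\<not> ?thesis"
  then have "\<forall>n. \<exists>x y. x \<in> X \<and> y \<in> X \<and> dist x y < inverse (real (Suc n)) \<and> b - K x y \<ge> e"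
    by (meson inverse_positive_iff_positive of_nat_0_less_iff zero_less_Suc not_le)
  then obtain s t where st: "\<And>n. s n \<in> X" "\<And>n. t n \<in> X" "\<And>n. dist (s n) (t n) < inverse (real (Suc n))"
      "\<And>n. b - K (s n) (t n) \<ge> e"
    by metis
  obtain x r where x: "x \<in> X" "strict_mono r" "(s \<circ> r) \<longlonglongrightarrow> x"
    using compact_imp_seq_compact[OF compact_X] st(1) unfolding seq_compact_def by metis
  have d0: "(\<lambda>n. dist (s n) (t n)) \<longlonglongrightarrow> 0"
    by (rule Lim_null_comparison[OF _ LIMSEQ_inverse_real_of_nat])
      (use st(3) in \<open>auto intro!: always_eventually less_imp_le\<close>)
  have "((\<lambda>n. dist (s n) (t n)) \<circ> r) \<longlonglongrightarrow> 0" by (rule LIMSEQ_subseq_LIMSEQ[OF d0 x(2)])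
  moreover have lim_s: "(\<lambda>n. s (r n)) \<longlonglongrightarrow> x" using x(3) by (simp add: o_def)
  then have "(\<lambda>n. dist (s (r n)) x) \<longlonglongrightarrow> 0" by (simp add: tendsto_dist_iff[symmetric])
  ultimately have sum0: "(\<lambda>n. dist (s (r n)) (t (r n)) + dist (s (r n)) x) \<longlonglongrightarrow> 0 + 0"
    unfolding o_def by (rule tendsto_add)
  have "(\<lambda>n. dist (t (r n)) x) \<longlonglongrightarrow> 0"
    by (rule Lim_null_comparison[OF _ sum0[unfolded add_0]])
      (use dist_triangle3 in \<open>auto intro!: always_eventually\<close>)
  then have lim_t: "(\<lambda>n. t (r n)) \<longlonglongrightarrow> x" by (simp add: tendsto_dist_iff[symmetric])
  have "(\<lambda>n. (b - K (s (r n)) x) + (b - K (t (r n)) x)) \<longlonglongrightarrow> (b - b) + (b - b)"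
    using st by (intro tendsto_intros K_tendsto x lim_s lim_t) auto
  moreover have "e \<le> (b - K (s (r n)) x) + (b - K (t (r n)) x)" for n
    using st(4)[of "r n"] K_triangle[OF st(1) x(1), of "r n" "t (r n)"] by (simp add: K_sym[of x])
  ultimately have "e \<le> (b - b) + (b - b)" by (intro LIMSEQ_le_const) auto
  then show False using e by simp
qed

text \<open>On one orbit send \<open>(f ^^ i) x\<close> to \<open>l ^ i\<close>. The kernel bounds
  the differences of these values, so the map is uniformly continuous and extends to the closure of
  the orbit, which contains \<open>X\<close>.\<close>

theorem ex_continuous_eigenfunction:
  "\<exists>g l. continuous_on X g \<and> (\<forall>x\<in>X. norm (g x) = 1 \<and> g (f x) = l * g x) \<and> norm l = 1 \<and> l \<noteq> (1::complex)"
proof -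
  obtain x where x: "x \<in> X" using X_nonempty by blast
  obtain l :: complex and \<delta> where l: "norm l = 1" "l \<noteq> 1" "\<delta> > 0"
    and bound: "\<And>j. \<delta> * norm (l ^ j - 1) \<le> b - K ((f ^^ j) x) x"
    using ex_eigenvalue_along_orbit[OF x] by blast
  define Orb where "Orb = {(f ^^ i) x |i. True}"
  have Orb_X: "Orb \<subseteq> X" using iter_in[OF x] by (auto simp: Orb_def)
  have XO: "X \<subseteq> closure Orb" using minimal x unfolding minimal_system_def Orb_def by blast
  have le: "\<delta> * norm (l ^ i - l ^ j) \<le> b - K ((f ^^ i) x) ((f ^^ j) x)" if "j \<le> i" for i j
  proof -
    have i: "i = j + (i - j)" using that by simp
    have "l ^ i - l ^ j = l ^ j * (l ^ (i - j) - 1)"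
      by (subst i, subst power_add) (simp add: algebra_simps)
    then have "norm (l ^ i - l ^ j) = norm (l ^ (i - j) - 1)" using l(1) by (simp add: norm_mult norm_power)
    also have "K ((f ^^ i) x) ((f ^^ j) x) = K ((f ^^ (i - j)) x) x"
      using K_inv_iter[OF iter_in[OF x] x, of j "i - j"] that by (simp flip: funpow_add[THEN fun_cong, unfolded o_apply])
    ultimately show ?thesis using bound[of "i - j"] by simp
  qed
  have bd: "\<delta> * norm (l ^ i - l ^ j) \<le> b - K ((f ^^ i) x) ((f ^^ j) x)" for i j
    using le[of i j] le[of j i] by (cases "j \<le> i") (auto simp: norm_minus_commute K_sym)
  \<comment> \<open>The orbit might repeat points; the next step shows that the chosen index does
    not affect the value, since \<open>b - K\<close> vanishes on the diagonal.\<close>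
  define g0 where "g0 = (\<lambda>y. l ^ (SOME i. (f ^^ i) x = y))"
  have g0: "g0 ((f ^^ i) x) = l ^ i" for i
  proof -
    define j where "j = (SOME j. (f ^^ j) x = (f ^^ i) x)"
    have "(f ^^ j) x = (f ^^ i) x" unfolding j_def by (rule someI) (rule refl)
    then have "\<delta> * norm (l ^ j - l ^ i) \<le> 0" using bd[of j i] K_diag[OF iter_in[OF x]] by simp
    then have "l ^ j = l ^ i" using l(3) by (simp add: mult_le_0_iff)
    then show ?thesis by (simp add: g0_def j_def)
  qed
  have "uniformly_continuous_on Orb g0"
    unfolding uniformly_continuous_on_def
  proof (intro allI impI)
    fix e :: real assume "e > 0"
    then obtain d where d: "d > 0" "\<And>y z. y \<in> X \<Longrightarrow> z \<in> X \<Longrightarrow> dist y z < d \<Longrightarrow> b - K y z < \<delta> * e"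
      using K_uniformly_continuous[of "\<delta> * e"] l(3) by auto
    have "dist (g0 z) (g0 y) < e" if yz: "y \<in> Orb" "z \<in> Orb" "dist z y < d" for y z
    proof -
      obtain i j where ij: "z = (f ^^ i) x" "y = (f ^^ j) x" using yz by (auto simp: Orb_def)
      have "\<delta> * norm (l ^ i - l ^ j) < \<delta> * e"
        using bd[of i j] d(2)[of z y] yz Orb_X unfolding ij by fastforce
      then show ?thesis using l(3) by (simp add: ij g0 dist_norm)
    qed
    then show "\<exists>d>0. \<forall>y\<in>Orb. \<forall>z\<in>Orb. dist z y < d \<longrightarrow> dist (g0 z) (g0 y) < e"
      using d(1) by blast
  qed
  then obtain g where g: "uniformly_continuous_on (closure Orb) g" "\<And>y. y \<in> Orb \<Longrightarrow> g0 y = g y"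
    by (rule uniformly_continuous_on_extension_on_closure) blast
  have cont: "continuous_on X g"
    using continuous_on_subset[OF uniformly_continuous_imp_continuous[OF g(1)] XO] .
  have "norm (g y) = 1 \<and> g (f y) = l * g y" if y: "y \<in> X" for y
  proof -
    obtain s where s: "\<And>n. s n \<in> Orb" "s \<longlonglongrightarrow> y"
      using subsetD[OF XO y] unfolding closure_sequential by blast
    have sX: "s n \<in> X" for n using s Orb_X by blast
    have gs: "norm (g (s n)) = 1 \<and> g (f (s n)) = l * g (s n)" for n
    proof -
      obtain i where i: "s n = (f ^^ i) x" using s(1)[of n] by (auto simp: Orb_def)
      have fs: "f (s n) = (f ^^ Suc i) x" by (simp add: i)
      have "(f ^^ Suc i) x \<in> Orb" unfolding Orb_def by blast
      then have "g (f (s n)) = l ^ Suc i" unfolding fs using g(2) g0[of "Suc i"] by metis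
      moreover have "g (s n) = l ^ i" using g(2)[OF s(1)[of n]] g0[of i] by (simp add: i)
      ultimately show ?thesis using l(1) by (simp add: norm_power)
    qed
    have lim: "(\<lambda>n. g (s n)) \<longlonglongrightarrow> g y"
      using continuous_on_tendsto_compose[OF cont s(2) y] sX by auto
    have lim_f: "(\<lambda>n. f (s n)) \<longlonglongrightarrow> f y"
      using continuous_on_tendsto_compose[OF cont_f s(2) y] sX by auto
    have "(\<lambda>n. g (f (s n))) \<longlonglongrightarrow> g (f y)"
      using continuous_on_tendsto_compose[OF cont lim_f f_in[OF y]] sX f_in by auto
    moreover have "(\<lambda>n. g (f (s n))) \<longlonglongrightarrow> l * g y"
      using tendsto_mult_left[OF lim, of l] gs by simp
    ultimately have "g (f y) = l * g y" by (rule LIMSEQ_unique)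
    moreover have "norm (g y) = 1"
      using tendsto_norm[OF lim] gs LIMSEQ_unique[OF _ tendsto_const] by auto
    ultimately show ?thesis by simp
  qed
  then show ?thesis using cont l by blast
qed

end

section \<open>From the topological hypotheses to the eigenfunction\<close>

lemma openin_Times_rectangle:
  assumes "openin (top_of_set (X \<times> X)) U" "U \<noteq> {}"
  obtains A B where "openin (top_of_set X) A" "openin (top_of_set X) B" "A \<noteq> {}" "B \<noteq> {}" "A \<times> B \<subseteq> U"
proof -
  obtain T where T: "open T" "U = (X \<times> X) \<inter> T" using assms(1) by (auto simp: openin_open)
  obtain x y where xy: "(x, y) \<in> U" using assms(2) by auto
  then have "(x, y) \<in> T" using T by blast
  then obtain A B where AB: "open A" "open B" "(x, y) \<in> A \<times> B" "A \<times> B \<subseteq> T"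
    using open_prod_elim[OF T(1)] by metis
  show ?thesis
  proof (rule that[of "X \<inter> A" "X \<inter> B"])
    show "X \<inter> A \<noteq> {}" "X \<inter> B \<noteq> {}" using xy AB T by auto
    show "(X \<inter> A) \<times> (X \<inter> B) \<subseteq> U" using AB T by auto
  qed (use AB in auto)
qed

lemma map_prod_funpow:
  fixes f :: "'a \<Rightarrow> 'a"
  shows "map_prod f f ^^ k = map_prod (f ^^ k) (f ^^ k)"
  by (induction k) (auto simp: fun_eq_iff)

lemma ex_eigenfunction_of_not_weakly_mixing:
  fixes X :: "'a::metric_space set" and f :: "'a \<Rightarrow> 'a"
  assumes ds: "dynamical_system X f" and inv: "invariant_prob X f M"
    and min: "minimal_system X f" and nwm: "\<not> top_weakly_mixing X f"
  shows "\<exists>g l. continuous_on X g \<and> (\<forall>x\<in>X. norm (g x) = 1 \<and> g (f x) = l * g x) \<and> norm l = 1 \<and> l \<noteq> (1::complex)"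
proof -
  obtain U V where UV: "openin (top_of_set (X \<times> X)) U" "openin (top_of_set (X \<times> X)) V" "U \<noteq> {}" "V \<noteq> {}"
    and sep: "\<And>k. k \<ge> 1 \<Longrightarrow> (map_prod f f ^^ k) ` U \<inter> V = {}"
    using nwm unfolding top_weakly_mixing_def top_transitive_def by blast
  obtain U1 U2 where U: "openin (top_of_set X) U1" "openin (top_of_set X) U2" "U1 \<noteq> {}" "U2 \<noteq> {}" "U1 \<times> U2 \<subseteq> U"
    using openin_Times_rectangle[OF UV(1,3)] .
  obtain V1 V2 where V: "openin (top_of_set X) V1" "openin (top_of_set X) V2" "V1 \<noteq> {}" "V2 \<noteq> {}" "V1 \<times> V2 \<subseteq> V"
    using openin_Times_rectangle[OF UV(2,4)] .
  interpret prob_space M using inv by (simp add: invariant_prob_def)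
  interpret non_mixing_mpt M X f U1 U2 V1 V2
  proof unfold_locales
    show "compact X" "continuous_on X f" "f ` X = X"
      using ds by (auto simp: dynamical_system_def homeomorphism_def)
    fix k :: nat and x y assume *: "k \<ge> 1" "x \<in> U1" "y \<in> U2" "(f ^^ k) x \<in> V1" "(f ^^ k) y \<in> V2"
    have "(x, y) \<in> U" using U(5) * by blast
    then have "((f ^^ k) x, (f ^^ k) y) \<in> (map_prod f f ^^ k) ` U"
      unfolding map_prod_funpow by (intro image_eqI[of _ _ "(x, y)"]) auto
    moreover have "((f ^^ k) x, (f ^^ k) y) \<in> V" using V(5) * by blast
    ultimately show False using sep[OF *(1)] by blast
  qed (use inv min U V in \<open>auto simp: invariant_prob_def\<close>)
  show ?thesis by (rule ex_continuous_eigenfunction)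
qed

text \<open>Disjoint neighbourhoods of two distinct values have open preimages, and no orbit passes
  from one preimage to the other.\<close>

lemma transitive_invariant_constant:
  fixes g :: "'a::metric_space \<Rightarrow> complex"
  assumes tr: "top_transitive X h" and g: "continuous_on X g"
    and hX: "\<And>x. x \<in> X \<Longrightarrow> h x \<in> X" and inv: "\<And>x. x \<in> X \<Longrightarrow> g (h x) = g x"
    and xy: "x \<in> X" "y \<in> X"
  shows "g x = g y"
proof (rule ccontr)
  assume "g x \<noteq> g y"
  then obtain A B where AB: "open A" "open B" "g x \<in> A" "g y \<in> B" "A \<inter> B = {}"
    by (metis hausdorff)
  have "openin (top_of_set X) (X \<inter> g -` A)" "openin (top_of_set X) (X \<inter> g -` B)"
    using continuous_openin_preimage_gen[OF g] AB by auto
  moreover have "X \<inter> g -` A \<noteq> {}" "X \<inter> g -` B \<noteq> {}" using xy AB by auto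
  ultimately obtain k where "(h ^^ k) ` (X \<inter> g -` A) \<inter> (X \<inter> g -` B) \<noteq> {}"
    using tr unfolding top_transitive_def by metis
  then obtain z where z: "z \<in> X" "g z \<in> A" "g ((h ^^ k) z) \<in> B" by blast
  have "(h ^^ k) z \<in> X \<and> g ((h ^^ k) z) = g z"
    using z(1) by (induction k) (auto simp: hX inv)
  then show False using z AB by auto
qed

section \<open>Herman's cocycle over an irrational rotation\<close>

lemma unimodular_eq_cis: "norm z = 1 \<Longrightarrow> \<exists>t. z = cis t"
  by (rule exI[of _ "Arg z"], subst cis_Arg) (auto simp: sgn_div_norm)

lemma unimodular_mult_cnj: "norm z = 1 \<Longrightarrow> z * cnj z = 1"
  by (metis complex_norm_square of_real_1 power_one)

text \<open>On \<open>\<real>\<^sup>2 = \<complex>\<close>, where \<open>diag(2, 1/2)\<close> acts as \<open>v \<mapsto> 5/4 v + 3/4 cnj v\<close>, the composition of the maps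
  \<open>v \<mapsto> diag(2, 1/2) (l ^ k * z * v)\<close> for \<open>k < n\<close> is \<open>v \<mapsto> a v + b cnj v\<close> with the following pair
  \<open>(a, b)\<close>.\<close>
primrec herman_coeff :: "complex \<Rightarrow> nat \<Rightarrow> complex \<Rightarrow> complex \<times> complex" where
  "herman_coeff l 0 z = (1, 0)"
| "herman_coeff l (Suc n) z =
     (let (p, q) = herman_coeff l n z; w = l ^ n * z
      in (5/4 * w * p + 3/4 * cnj w * cnj q, 5/4 * w * q + 3/4 * cnj w * cnj p))"

definition herman_a :: "complex \<Rightarrow> nat \<Rightarrow> complex \<Rightarrow> complex" where
  "herman_a l n z = fst (herman_coeff l n z)"
definition herman_b :: "complex \<Rightarrow> nat \<Rightarrow> complex \<Rightarrow> complex" where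
  "herman_b l n z = snd (herman_coeff l n z)"

lemma herman_a_0 [simp]: "herman_a l 0 z = 1" and herman_b_0 [simp]: "herman_b l 0 z = 0"
  by (simp_all add: herman_a_def herman_b_def)

lemma herman_a_Suc: "herman_a l (Suc n) z = 5/4 * (l ^ n * z) * herman_a l n z + 3/4 * cnj (l ^ n * z) * cnj (herman_b l n z)"
  and herman_b_Suc: "herman_b l (Suc n) z = 5/4 * (l ^ n * z) * herman_b l n z + 3/4 * cnj (l ^ n * z) * cnj (herman_a l n z)"
  by (simp_all add: herman_a_def herman_b_def Let_def case_prod_beta)

text \<open>The definition splits off the last factor of the product; here the first one is split
  off, and the base point moves to \<open>l * z\<close>.\<close>

lemma herman_a_b_Suc_right:
  "herman_a l (Suc n) z = z * (5/4 * herman_a l n (l * z) + 3/4 * herman_b l n (l * z)) \<and>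
   herman_b l (Suc n) z = cnj z * (3/4 * herman_a l n (l * z) + 5/4 * herman_b l n (l * z))"
proof (induction n)
  case 0
  then show ?case by (simp add: herman_a_Suc herman_b_Suc)
next
  case (Suc n)
  have w: "l ^ Suc n * z = l ^ n * (l * z)"
    by simp
  show ?case
    unfolding herman_a_Suc[of l "Suc n" z] herman_b_Suc[of l "Suc n" z] Suc.IH[THEN conjunct1] Suc.IH[THEN conjunct2] w
      herman_a_Suc[of l n "l*z"] herman_b_Suc[of l n "l * z"]
    by (simp add: algebra_simps)
qed

lemma herman_a_Suc_right: "herman_a l (Suc n) z = z * (5/4 * herman_a l n (l * z) + 3/4 * herman_b l n (l * z))"
  and herman_b_Suc_right: "herman_b l (Suc n) z = cnj z * (3/4 * herman_a l n (l * z) + 5/4 * herman_b l n (l * z))"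
  using herman_a_b_Suc_right by auto

lemma continuous_on_herman_a: "continuous_on S (herman_a l n)" and continuous_on_herman_b: "continuous_on S (herman_b l n)"
proof (induction n)
  case 0
  { case 1 then show ?case by (simp add: herman_a_def) next case 2 then show ?case by (simp add: herman_b_def) }
next
  case (Suc n)
  { case 1 then show ?case unfolding herman_a_Suc using Suc by (intro continuous_intros)
  next case 2 then show ?case unfolding herman_b_Suc using Suc by (intro continuous_intros) }
qed

text \<open>The left side is the determinant of \<open>v \<mapsto> a v + b cnj v\<close>, and each
  factor has determinant \<open>25/16 - 9/16 = 1\<close>.\<close>

lemma herman_a_b_det:
  assumes "norm l = 1" "norm z = 1"
  shows "(norm (herman_a l n z))\<^sup>2 - (norm (herman_b l n z))\<^sup>2 = 1"
proof -
  have "herman_a l n z * cnj (herman_a l n z) - herman_b l n z * cnj (herman_b l n z) = 1"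
  proof (induction n)
    case (Suc n)
    define w where "w = l ^ n * z"
    have w: "w * cnj w = 1"
      using assms by (intro unimodular_mult_cnj) (simp add: w_def norm_mult norm_power)
    have "herman_a l (Suc n) z * cnj (herman_a l (Suc n) z) - herman_b l (Suc n) z * cnj (herman_b l (Suc n) z)
      = (w * cnj w) * (herman_a l n z * cnj (herman_a l n z) - herman_b l n z * cnj (herman_b l n z))"
      unfolding herman_a_Suc herman_b_Suc w_def[symmetric] by (simp add: algebra_simps)
    then show ?case using Suc w by simp
  qed auto
  then have "complex_of_real ((norm (herman_a l n z))\<^sup>2 - (norm (herman_b l n z))\<^sup>2) = of_real 1"
    by (simp only: of_real_diff complex_norm_square of_real_1)
  then show ?thesis
    using of_real_eq_iff by blast
qed

lemma norm_herman_a_ge_1: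
  assumes "norm l = 1" "norm z = 1"
  shows "1 \<le> norm (herman_a l n z)"
proof (rule power2_le_imp_le)
  show "1\<^sup>2 \<le> (norm (herman_a l n z))\<^sup>2"
    using herman_a_b_det[OF assms, of n] zero_le_power2[of "norm (herman_b l n z)"] unfolding power_one by linarith
qed simp

lemma norm_herman_b_le:
  assumes "norm l = 1" "norm z = 1"
  shows "norm (herman_b l n z) \<le> norm (herman_a l n z)"
proof (rule power2_le_imp_le)
  show "(norm (herman_b l n z))\<^sup>2 \<le> (norm (herman_a l n z))\<^sup>2"
    using herman_a_b_det[OF assms, of n] by linarith
qed simp

text \<open>A connected subset of the countable set of multiples of \<open>2 * pi * \<i>\<close> has
  at most one point.\<close>

lemma continuous_log_one_constant:
  fixes E :: "real \<Rightarrow> complex"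
  assumes "continuous_on UNIV E" "\<And>t. exp (E t) = 1"
  shows "E s = E t"
proof (rule ccontr)
  assume "E s \<noteq> E t"
  moreover have "connected (range E)"
    using assms(1) connected_UNIV by (rule connected_continuous_image)
  ultimately have "uncountable (range E)"
    by (intro connected_uncountable[of _ "E s" "E t"]) auto
  moreover have "range E \<subseteq> range (\<lambda>k::int. complex_of_real (real_of_int (2 * k) * pi) * \<i>)"
  proof
    fix z assume "z \<in> range E"
    then have "exp z = 1" using assms(2) by auto
    then obtain k :: int where "Im z = of_int (2 * k) * pi" "Re z = 0"
      by (auto simp: exp_eq_1)
    then have "z = complex_of_real (real_of_int (2 * k) * pi) * \<i>"
      by (auto simp: complex_eq_iff)
    then show "z \<in> range (\<lambda>k::int. complex_of_real (real_of_int (2 * k) * pi) * \<i>)" by blast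
  qed
  ultimately show False
    by (meson countable_image countable_subset countableI_type)
qed

text \<open>Otherwise the two recursions for \<open>herman_b l (Suc n)\<close> would give it the winding numbers
  \<open>d - 1\<close> and \<open>d + 1\<close> along the circle, where \<open>d\<close> is the winding number of \<open>herman_b l n\<close>.\<close>
lemma ex_small_herman_b:
  assumes l: "norm l = 1"
  shows "\<exists>z. norm z = 1 \<and> 5/4 * norm (herman_b l n z) \<le> 3/4 * norm (herman_a l n z)"
proof (rule ccontr)
  assume "\<not> ?thesis"
  then have big: "3/4 * norm (herman_a l n z) < 5/4 * norm (herman_b l n z)" if "norm z = 1" for z
    using that by force
  have nz: "herman_b l n z \<noteq> 0" if "norm z = 1" for z
    using big[OF that] by auto
  obtain \<theta> where \<theta>: "l = cis \<theta>"
    using unimodular_eq_cis[OF l] by blast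
  have contcis: "continuous_on UNIV cis"
    by (intro continuous_intros)
  have "continuous_on UNIV (\<lambda>t. herman_b l n (cis t))"
    by (rule continuous_on_compose2[OF continuous_on_herman_b[of UNIV] contcis]) auto
  then obtain L where L: "continuous_on UNIV L" "\<And>t. herman_b l n (cis t) = exp (L t)"
    using continuous_logarithm_on_contractible[of "UNIV :: real set" "\<lambda>t. herman_b l n (cis t)"] nz
    by (metis UNIV_I contractible_UNIV norm_cis)
  \<comment> \<open>\<open>u\<close> and \<open>v\<close> are the ratios of the smaller to the
    larger term in the two recursions. By \<open>big\<close> they have modulus below 1, so
    \<open>Ln (1 + u t)\<close> and \<open>Ln (1 + v t)\<close> are continuous.\<close>
  define u where "u = (\<lambda>t. 3 * herman_a l n (cis t) / (5 * herman_b l n (cis t)))"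
  define v where "v = (\<lambda>t. 3 * (cnj (l ^ n * cis t))\<^sup>2 * cnj (herman_a l n (cis t)) / (5 * herman_b l n (cis t)))"
  have nl: "cnj (l ^ n * cis t) * (l ^ n * cis t) = 1" for t
    using l unimodular_mult_cnj[of "l ^ n * cis t"] by (simp add: norm_mult norm_power mult.commute)
  have u1: "norm (u t) < 1" for t
    using big[of "cis t"] nz[of "cis t"] by (simp add: u_def norm_mult norm_divide field_simps)
  have v1: "norm (v t) < 1" for t
    using big[of "cis t"] nz[of "cis t"] l
    by (simp add: v_def norm_mult norm_divide norm_power field_simps)
  have pos: "1 + w \<notin> \<real>\<^sub>\<le>\<^sub>0" if "norm w < 1" for w :: complex
  proof
    assume "1 + w \<in> \<real>\<^sub>\<le>\<^sub>0"
    then have "1 + Re w \<le> 0" by (auto simp: complex_nonpos_Reals_iff)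
    then show False using that abs_Re_le_cmod[of w] by linarith
  qed
  have contu: "continuous_on UNIV u"
    unfolding u_def using nz[of "cis _"]
    by (intro continuous_intros continuous_on_compose2[OF continuous_on_herman_b[of UNIV] contcis]
      continuous_on_compose2[OF continuous_on_herman_a[of UNIV] contcis]) auto
  have contv: "continuous_on UNIV v"
    unfolding v_def using nz[of "cis _"]
    by (intro continuous_intros continuous_on_compose2[OF continuous_on_herman_b[of UNIV] contcis]
      continuous_on_compose2[OF continuous_on_herman_a[of UNIV] contcis]) auto
  \<comment> \<open>Both brackets are logarithms of \<open>herman_b l (Suc n) (cis t)\<close> up to
    the common factor 5/4, so \<open>E\<close> is constant. Over one turn the increments of
    \<open>L\<close> cancel and those of the \<open>Ln\<close> terms vanish, but \<open>- t\<close>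
    and \<open>t\<close> leave a difference of \<open>4 * pi\<close>.\<close>
  define E where "E = (\<lambda>t. (\<i> * of_real (- t) + L (t + \<theta>) + Ln (1 + u (t + \<theta>)))
      - (\<i> * of_real (n * \<theta>) + \<i> * of_real t + L t + Ln (1 + v t)))"
  have "exp (E t) = 1" for t
  proof -
    have lcis: "l * cis t = cis (t + \<theta>)" by (simp add: \<theta> cis_mult add.commute)
    have ln: "l ^ n = cis (n * \<theta>)" by (simp add: \<theta> Complex.DeMoivre)
    have n1: "1 + u (t + \<theta>) \<noteq> 0" "1 + v t \<noteq> 0"
      using pos[OF u1[of "t+\<theta>"]] pos[OF v1[of t]] by auto
    have "herman_b l (Suc n) (cis t) = 5/4 * cnj (cis t) * exp (L (t + \<theta>)) * (1 + u (t + \<theta>))"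
      unfolding herman_b_Suc_right lcis u_def L(2)[symmetric] using nz[of "cis (t+\<theta>)"]
      by (simp add: field_simps)
    moreover have "herman_b l (Suc n) (cis t) = 5/4 * (l ^ n * cis t) * exp (L t) * (1 + v t)"
    proof -
      have "5/4 * (l ^ n * cis t) * herman_b l n (cis t) * (1 + v t) =
        5/4 * (l ^ n * cis t) * herman_b l n (cis t) + 3/4 * ((l ^ n * cis t) * (cnj (l ^ n * cis t))\<^sup>2) * cnj (herman_a l n (cis t))"
        unfolding v_def using nz[of "cis t"] by (simp add: field_simps)
      also have "(l ^ n * cis t) * (cnj (l ^ n * cis t))\<^sup>2 = cnj (l ^ n * cis t)"
        using nl[of t] by (simp add: power2_eq_square algebra_simps)
      finally show ?thesis unfolding herman_b_Suc L(2)[symmetric] by simp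
    qed
    ultimately have eq: "cis (-t) * exp (L (t + \<theta>)) * (1 + u (t + \<theta>))
        = cis (n * \<theta>) * cis t * exp (L t) * (1 + v t)"
      by (simp add: cis_cnj ln mult_ac)
    have "exp (E t) = cis (-t) * exp (L (t + \<theta>)) * (1 + u (t + \<theta>))
        / (cis (n * \<theta>) * cis t * exp (L t) * (1 + v t))"
      using n1 by (simp only: E_def exp_add exp_diff cis_conv_exp exp_Ln[OF n1(1)] exp_Ln[OF n1(2)])
    then show ?thesis
      using n1 unfolding eq by simp
  qed
  moreover have "continuous_on UNIV E"
    unfolding E_def using pos[OF u1] pos[OF v1]
    by (intro continuous_intros continuous_on_compose2[OF L(1)] continuous_on_compose2[OF contu]
       contv L(1)) auto
  ultimately have "E (2 * pi) = E 0"
    using continuous_log_one_constant by blast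
  moreover have "L (\<theta> + 2 * pi) - L \<theta> = L (0 + 2 * pi) - L 0"
  proof (rule continuous_log_one_constant[of "\<lambda>t. L (t + 2 * pi) - L t"])
    show "continuous_on UNIV (\<lambda>t. L (t + 2 * pi) - L t)"
      by (intro continuous_intros continuous_on_compose2[OF L(1)]) auto
    show "exp (L (t + 2 * pi) - L t) = 1" for t
      using L(2)[of t] L(2)[of "t + 2*pi"] by (simp add: exp_diff flip: cis_mult)
  qed
  moreover have "u (2 * pi + \<theta>) = u \<theta>" "v (2 * pi) = v 0"
    by (simp_all add: u_def v_def flip: cis_mult)
  ultimately have "\<i> * of_real (4 * pi) = 0"
    unfolding E_def by (simp add: algebra_simps)
  then show False by simp
qed

text \<open>With \<open>a\<close> and \<open>b\<close> for the two coefficients,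
  \<open>\<bar>b\<bar> \<le> 3/5 \<bar>a\<bar>\<close> and determinant 1 give
  \<open>16/25 \<bar>a\<bar>\<^sup>2 \<le> 1\<close>.\<close>

lemma ex_small_herman_a:
  assumes l: "norm l = 1"
  shows "\<exists>z. norm z = 1 \<and> norm (herman_a l n z) \<le> 5/4"
proof -
  obtain z where z: "norm z = 1" "5/4 * norm (herman_b l n z) \<le> 3/4 * norm (herman_a l n z)"
    using ex_small_herman_b[OF l] by blast
  have "norm (herman_b l n z) \<le> 3/5 * norm (herman_a l n z)" using z by simp
  then have "(norm (herman_b l n z))\<^sup>2 \<le> (3/5 * norm (herman_a l n z))\<^sup>2"
    by (intro power_mono) auto
  then have "(norm (herman_a l n z))\<^sup>2 \<le> (5/4)\<^sup>2"
    using herman_a_b_det[OF l z(1), of n] by (simp add: power2_eq_square)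
  then have "norm (herman_a l n z) \<le> 5/4"
    by (rule power2_le_imp_le) simp
  then show ?thesis using z by blast
qed

text \<open>On the unit circle \<open>cnj z\<close> is \<open>1 / z\<close>, so a factor
  \<open>z\<close> can be pulled out of every step; what remains is a polynomial in
  \<open>u = (cnj z)\<^sup>2\<close>. At \<open>u = 0\<close> only the terms with 5/4 survive in
  \<open>P\<close>, because \<open>Q\<close> vanishes there.\<close>

lemma herman_a_b_polynomial:
  assumes l: "norm l = 1"
  obtains P Q c where "P holomorphic_on UNIV" "Q holomorphic_on UNIV" "norm c = 1"
    "P 0 = (5/4) ^ n" "Q 0 = 0"
    "\<And>z. norm z = 1 \<Longrightarrow> herman_a l n z = c * z ^ n * P ((cnj z)\<^sup>2)"
    "\<And>z. norm z = 1 \<Longrightarrow> herman_b l n z = c * z ^ n * Q ((cnj z)\<^sup>2)"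
proof (induction n arbitrary: thesis)
  case 0
  show ?case by (rule 0[of "\<lambda>_. 1" "\<lambda>_. 0" 1]) auto
next
  case (Suc n)
  from Suc.IH obtain P Q c where PQ: "P holomorphic_on UNIV" "Q holomorphic_on UNIV" "norm c = 1"
    "P 0 = (5/4) ^ n" "Q 0 = 0"
    "\<And>z. norm z = 1 \<Longrightarrow> herman_a l n z = c * z ^ n * P ((cnj z)\<^sup>2)"
    "\<And>z. norm z = 1 \<Longrightarrow> herman_b l n z = c * z ^ n * Q ((cnj z)\<^sup>2)"
    by blast
  \<comment> \<open>Replacing \<open>z\<close> by \<open>l * z\<close> multiplies
    \<open>(cnj z)\<^sup>2\<close> by \<open>k\<close>.\<close>
  define k where "k = (cnj l)\<^sup>2"
  have Pk: "(\<lambda>u. P (k * u)) holomorphic_on UNIV" "(\<lambda>u. Q (k * u)) holomorphic_on UNIV"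
    using holomorphic_on_compose_gen[of "\<lambda>u. k * u" UNIV P UNIV]
      holomorphic_on_compose_gen[of "\<lambda>u. k * u" UNIV Q UNIV] PQ(1,2)
    by (auto simp: o_def intro!: holomorphic_intros)
  show ?case
  proof (rule Suc.prems[of "\<lambda>u. 5/4 * P (k * u) + 3/4 * Q (k * u)"
        "\<lambda>u. u * (3/4 * P (k * u) + 5/4 * Q (k * u))" "c * l ^ n"])
    show "(\<lambda>u. 5/4 * P (k * u) + 3/4 * Q (k * u)) holomorphic_on UNIV"
      "(\<lambda>u. u * (3/4 * P (k * u) + 5/4 * Q (k * u))) holomorphic_on UNIV"
      using Pk by (auto intro!: holomorphic_intros)
    fix z :: complex assume z: "norm z = 1"
    have lz: "norm (l * z) = 1" using l z by (simp add: norm_mult)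
    have zz: "z * (cnj z * x) = x" for x
      using unimodular_mult_cnj[OF z] by (simp add: mult.assoc[symmetric])
    show "herman_a l (Suc n) z = c * l ^ n * z ^ Suc n * (5/4 * P (k * (cnj z)\<^sup>2) + 3/4 * Q (k * (cnj z)\<^sup>2))"
      unfolding herman_a_Suc_right PQ(6)[OF lz] PQ(7)[OF lz]
      by (simp add: k_def power_mult_distrib algebra_simps)
    show "herman_b l (Suc n) z = c * l ^ n * z ^ Suc n * ((cnj z)\<^sup>2 * (3/4 * P (k * (cnj z)\<^sup>2) + 5/4 * Q (k * (cnj z)\<^sup>2)))"
      unfolding herman_b_Suc_right PQ(6)[OF lz] PQ(7)[OF lz]
      by (simp add: k_def power_mult_distrib power2_eq_square zz algebra_simps)
  qed (use PQ l in \<open>auto simp: norm_mult norm_power\<close>)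
qed

text \<open>On the circle the modulus is that of \<open>P\<close> at a boundary point of the unit
  disc, and by the maximum principle it somewhere reaches \<open>norm (P 0)\<close>.\<close>

lemma ex_large_herman_a:
  assumes l: "norm l = 1"
  shows "\<exists>z. norm z = 1 \<and> (5/4) ^ n \<le> norm (herman_a l n z)"
proof -
  obtain P Q c where PQ: "P holomorphic_on UNIV" "norm c = 1" "P 0 = (5/4) ^ n"
    "\<And>z. norm z = 1 \<Longrightarrow> herman_a l n z = c * z ^ n * P ((cnj z)\<^sup>2)"
    using herman_a_b_polynomial[OF l] by metis
  have "continuous_on (sphere 0 1) (\<lambda>u. norm (P u))"
    using PQ(1) by (intro continuous_intros holomorphic_on_imp_continuous_on) (auto intro: holomorphic_on_subset)
  then obtain u where u: "norm u = 1" "\<And>v. norm v = 1 \<Longrightarrow> norm (P v) \<le> norm (P u)"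
    using continuous_attains_sup[of "sphere (0::complex) 1" "\<lambda>u. norm (P u)"] by auto
  have "norm (P 0) \<le> norm (P u)"
  proof (rule maximum_modulus_frontier[of P "cball 0 1"])
    show "continuous_on (closure (cball 0 1)) P"
      using PQ(1) by (intro holomorphic_on_imp_continuous_on) (auto intro: holomorphic_on_subset)
  qed (use u PQ(1) in \<open>auto intro: holomorphic_on_subset\<close>)
  then have big: "(5/4) ^ n \<le> norm (P u)" by (simp add: PQ norm_power)
  \<comment> \<open>The square root is taken so that \<open>(cnj z)\<^sup>2 = u\<close>.\<close>
  define z where "z = cnj (csqrt u)"
  have "norm z = 1" using u by (simp add: z_def)
  moreover have "norm (herman_a l n z) = norm (P u)"
    using \<open>norm z = 1\<close> by (simp add: PQ norm_mult norm_power) (simp add: z_def)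
  ultimately show ?thesis using big by auto
qed

section \<open>Density of irrational rotations and failure of uniform convergence\<close>

lemma rotation_orbit_dense:
  fixes l z w :: complex
  assumes l: "norm l = 1" and irr: "\<And>q. q \<ge> 1 \<Longrightarrow> l ^ q \<noteq> 1"
    and zw: "norm z = 1" "norm w = 1" and e: "e > 0"
  shows "\<exists>n. norm (l ^ n * z - w) < e"
proof -
  have ex: "\<exists>t. u = cis (2 * pi * t)" if u: "norm u = 1" for u
  proof -
    obtain t where "u = cis t" using unimodular_eq_cis[OF u] by blast
    then have "u = cis (2 * pi * (t / (2 * pi)))" by simp
    then show ?thesis by blast
  qed
  obtain \<theta> where \<theta>: "l = cis (2 * pi * \<theta>)" using ex l by blast
  have "norm (w / z) = 1" using zw by (simp add: norm_divide)
  then obtain s where s: "w / z = cis (2 * pi * s)" using ex by blast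
  have fr: "cis (2 * pi * frac t) = cis (2 * pi * t)" for t
    by (simp add: frac_def right_diff_distrib cis_divide[symmetric])
  have "\<theta> \<notin> \<rat>"
  proof
    assume "\<theta> \<in> \<rat>"
    then obtain a b :: int where ab: "\<theta> = of_int a / of_int b" "b > 0" by (meson Rats_cases')
    have "l ^ nat b = cis (2 * pi * of_int a)"
      using ab by (simp add: \<theta> Complex.DeMoivre)
    then have "l ^ nat b = 1" by simp
    then show False using irr[of "nat b"] ab by simp
  qed
  have "continuous_on UNIV (\<lambda>t. cis (2 * pi * t))" by (intro continuous_intros)
  then obtain d where d: "d > 0" "\<And>t. \<bar>t - frac s\<bar> < d \<Longrightarrow> norm (cis (2 * pi * t) - cis (2 * pi * frac s)) < e"
    using e unfolding continuous_on_iff by (force simp: dist_norm)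
  obtain k where "\<bar>frac (real k * \<theta>) - frac s\<bar> < d"
    using Kronecker_approx_1_explicit[OF \<open>\<theta> \<notin> \<rat>\<close> _ _ d(1), of "frac s"]
    by (meson frac_ge_0 frac_lt_1 less_imp_le)
  then have "norm (cis (2 * pi * frac (real k * \<theta>)) - cis (2 * pi * frac s)) < e"
    by (rule d(2))
  then have *: "norm (l ^ k - w / z) < e"
    unfolding fr s by (simp add: \<theta> Complex.DeMoivre algebra_simps)
  have "z \<noteq> 0" using zw by auto
  then have "l ^ k * z - w = (l ^ k - w / z) * z" by (simp add: field_simps)
  then have "norm (l ^ k * z - w) < e" using * zw by (simp add: norm_mult)
  then show ?thesis by blast
qed

text \<open>A uniform limit is continuous and does not decrease along the rotation, so by density of
  orbits it is constant. The points of small and of large growth at a single late time contradict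
  this.\<close>

lemma herman_a_not_uniformly_convergent:
  assumes l: "norm l = 1" and irr: "\<And>q. q \<ge> 1 \<Longrightarrow> l ^ q \<noteq> 1"
  shows "\<not> uniformly_convergent_on (sphere 0 1) (\<lambda>n z. ln (norm (herman_a l n z)) / real n)"
proof
  let ?\<phi> = "\<lambda>n z. ln (norm (herman_a l n z)) / real n"
  assume "uniformly_convergent_on (sphere 0 1) ?\<phi>"
  then obtain \<Lambda> where \<Lambda>: "uniform_limit (sphere 0 1) ?\<phi> \<Lambda> sequentially"
    unfolding uniformly_convergent_on_def by blast
  have ge1: "1 \<le> norm (herman_a l n z)" if "norm z = 1" for n z
    using norm_herman_a_ge_1[OF l that] .
  have "continuous_on (sphere 0 1) (?\<phi> n)" for n
  proof -
    have "norm (herman_a l n z) \<noteq> 0" if "z \<in> sphere 0 1" for z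
      using ge1[of z n] that by auto
    then have "continuous_on (sphere 0 1) (\<lambda>z. ln (norm (herman_a l n z)) * inverse (real n))"
      by (intro continuous_intros continuous_on_herman_a) auto
    then show ?thesis by (simp only: divide_inverse)
  qed
  then have cont: "continuous_on (sphere 0 1) \<Lambda>"
    by (intro uniform_limit_theorem[OF _ \<Lambda>]) auto
  have lim: "(\<lambda>n. ?\<phi> n z) \<longlonglongrightarrow> \<Lambda> z" if "norm z = 1" for z
    using tendsto_uniform_limitI[OF \<Lambda>] that by simp
  have step: "\<Lambda> z \<le> \<Lambda> (l * z)" if z: "norm z = 1" for z
  proof -
    have lz: "norm (l * z) = 1" using z l by (simp add: norm_mult)
    \<comment> \<open>Removing the first factor changes the norm by at most
      \<open>5/4 + 3/4 = 2\<close>. The case \<open>n = 0\<close> is separate because the quotient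
      with denominator 0 is 0.\<close>
    have *: "?\<phi> (Suc n) z \<le> ln 2 / real (Suc n) + ?\<phi> n (l * z)" for n
    proof (cases "n = 0")
      case False
      have "norm (herman_a l (Suc n) z) \<le> 5/4 * norm (herman_a l n (l * z)) + 3/4 * norm (herman_b l n (l * z))"
        unfolding herman_a_Suc_right norm_mult z using norm_triangle_ineq[of "5/4 * herman_a l n (l * z)" "3/4 * herman_b l n (l * z)"]
        by (simp add: norm_mult)
      also have "\<dots> \<le> 2 * norm (herman_a l n (l * z))"
        using norm_herman_b_le[OF l lz, of n] by simp
      finally have "ln (norm (herman_a l (Suc n) z)) \<le> ln (2 * norm (herman_a l n (l * z)))"
        using ge1[OF z, of "Suc n"] ge1[OF lz, of n] by (subst ln_le_cancel_iff; linarith)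
      also have "\<dots> = ln 2 + ln (norm (herman_a l n (l * z)))"
        using ge1[OF lz, of n] by (subst ln_mult) auto
      finally have "?\<phi> (Suc n) z \<le> (ln 2 + ln (norm (herman_a l n (l * z)))) / real (Suc n)"
        by (intro divide_right_mono) auto
      also have "\<dots> \<le> ln 2 / real (Suc n) + ?\<phi> n (l * z)"
        unfolding add_divide_distrib using ge1[OF lz, of n] False
        by (intro add_left_mono divide_left_mono) (auto intro: ln_ge_zero)
      finally show ?thesis .
    next
      case True
      have "norm (herman_a l (Suc 0) z) \<le> 2" using z by (simp add: herman_a_Suc norm_mult)
      then have "ln (norm (herman_a l (Suc 0) z)) \<le> ln 2"
        using ge1[OF z, of "Suc 0"] by (subst ln_le_cancel_iff) linarith+
      then show ?thesis using True by simp
    qed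
    have lim1: "(\<lambda>n. ln 2 / real (Suc n) + ?\<phi> n (l * z)) \<longlonglongrightarrow> 0 + \<Lambda> (l * z)"
      by (intro tendsto_add lim[OF lz]) real_asymp
    have "(\<lambda>n. ?\<phi> (Suc n) z) \<longlonglongrightarrow> \<Lambda> z"
      using lim[OF z] by (rule LIMSEQ_Suc)
    from LIMSEQ_le[OF this lim1] have "\<Lambda> z \<le> 0 + \<Lambda> (l * z)"
      using * by blast
    then show ?thesis by simp
  qed
  have step': "\<Lambda> z \<le> \<Lambda> (l ^ n * z)" if z: "norm z = 1" for z n
  proof (induction n)
    case (Suc n)
    have "norm (l ^ n * z) = 1" using z l by (simp add: norm_mult norm_power)
    from step[OF this] Suc show ?case by (simp add: mult_ac)
  qed simp
  have mono: "\<Lambda> z \<le> \<Lambda> w" if zw: "norm z = 1" "norm w = 1" for z w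
  proof (rule field_le_epsilon)
    fix e :: real assume "e > 0"
    with cont zw obtain d where d: "d > 0" "\<And>y. norm y = 1 \<Longrightarrow> dist y w < d \<Longrightarrow> dist (\<Lambda> y) (\<Lambda> w) < e"
      unfolding continuous_on_iff by force
    obtain n where n: "norm (l ^ n * z - w) < d"
      using rotation_orbit_dense[OF l irr zw d(1)] by blast
    have "norm (l ^ n * z) = 1" using zw l by (simp add: norm_mult norm_power)
    from d(2)[OF this] n have "dist (\<Lambda> (l ^ n * z)) (\<Lambda> w) < e" by (simp add: dist_norm)
    then show "\<Lambda> z \<le> \<Lambda> w + e"
      using step'[OF zw(1), of n] by (simp add: dist_real_def)
  qed
  \<comment> \<open>The exponents at time \<open>n\<close> are below \<open>e\<close> at
    \<open>z\<close> and at least \<open>4 * e\<close> at \<open>w\<close>; an error below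
    \<open>e\<close> on each side keeps the limits apart, below \<open>2 * e\<close> and above
    \<open>3 * e\<close>.\<close>
  define e where "e = ln (5/4::real) / 4"
  have e: "e > 0" by (simp add: e_def)
  from \<Lambda> have "\<forall>\<^sub>F n in sequentially. \<forall>z\<in>sphere 0 1. dist (?\<phi> n z) (\<Lambda> z) < e"
    using e unfolding uniform_limit_iff by blast
  moreover have "\<forall>\<^sub>F n in sequentially. ln (5/4::real) / real n < e"
    using e by real_asymp
  ultimately have "\<forall>\<^sub>F n in sequentially. n > 0 \<and> ln (5/4::real) / real n < e \<and> (\<forall>z\<in>sphere 0 1. dist (?\<phi> n z) (\<Lambda> z) < e)"
    using eventually_gt_at_top[of 0] by eventually_elim auto
  then obtain n where n: "n > 0" "ln (5/4::real) / real n < e" "\<And>z. norm z = 1 \<Longrightarrow> dist (?\<phi> n z) (\<Lambda> z) < e"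
    by (auto dest!: eventually_happens)
  obtain z where z: "norm z = 1" "norm (herman_a l n z) \<le> 5/4" using ex_small_herman_a[OF l] by blast
  obtain w where w: "norm w = 1" "(5/4) ^ n \<le> norm (herman_a l n w)" using ex_large_herman_a[OF l] by blast
  have "?\<phi> n z \<le> ln (5/4) / n"
    using z ge1[OF z(1), of n] by (intro divide_right_mono ln_mono) auto
  then have 1: "\<Lambda> z < 2 * e" using n z by (smt (verit) dist_real_def)
  have "ln ((5/4) ^ n) \<le> ln (norm (herman_a l n w))"
    using w(2) by (intro ln_mono) auto
  then have "n * ln (5/4) \<le> ln (norm (herman_a l n w))"
    by (simp add: ln_realpow del: power_divide)
  then have "ln (5/4) \<le> ?\<phi> n w"
    using n(1) by (simp add: field_simps)
  then have 2: "\<Lambda> w > 3 * e" using n(3)[OF w(1)] e unfolding dist_real_def abs_diff_less_iff by (simp add: e_def)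
  from 1 2 mono[OF w(1) z(1)] e show False by linarith
qed

section \<open>Realization by real matrices and transfer to the system\<close>

text \<open>The real matrix of \<open>v \<mapsto> a v + b (cnj v)\<close> on the coordinates \<open>p, q\<close>, extended by the identity.\<close>
definition planar_matrix :: "'m \<Rightarrow> 'm \<Rightarrow> complex \<Rightarrow> complex \<Rightarrow> real ^ 'm ^ 'm" where
  "planar_matrix p q a b = (\<chi> i j.
     if i = p then (if j = p then Re a + Re b else if j = q then Im b - Im a else 0)
     else if i = q then (if j = p then Im a + Im b else if j = q then Re a - Re b else 0)
     else if i = j then 1 else 0)"

lemma planar_matrix_row_sum:
  fixes p q :: "'m::finite"
  assumes "p \<noteq> q"
  shows "(\<Sum>k\<in>UNIV. planar_matrix p q a b $ i $ k * v k) =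
    (if i = p then (Re a + Re b) * v p + (Im b - Im a) * v q
     else if i = q then (Im a + Im b) * v p + (Re a - Re b) * v q else v i)"
proof -
  consider "i = p \<or> i = q" | "i \<noteq> p" "i \<noteq> q" by blast
  then show ?thesis
  proof cases
    case 1
    then have "(\<Sum>k\<in>UNIV. planar_matrix p q a b $ i $ k * v k) = (\<Sum>k\<in>{p, q}. planar_matrix p q a b $ i $ k * v k)"
      by (intro sum.mono_neutral_right) (auto simp: planar_matrix_def)
    also have "\<dots> = (if i = p then (Re a + Re b) * v p + (Im b - Im a) * v q
     else if i = q then (Im a + Im b) * v p + (Re a - Re b) * v q else v i)"
      using 1 assms by (auto simp: planar_matrix_def)
    finally show ?thesis .
  next
    case 2
    then have "(\<Sum>k\<in>UNIV. planar_matrix p q a b $ i $ k * v k) = (\<Sum>k\<in>{i}. planar_matrix p q a b $ i $ k * v k)"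
      by (intro sum.mono_neutral_right) (auto simp: planar_matrix_def)
    also have "\<dots> = v i" using 2 by (simp add: planar_matrix_def)
    finally show ?thesis using 2 by simp
  qed
qed

lemma planar_matrix_mult:
  fixes p q :: "'m::finite"
  assumes "p \<noteq> q"
  shows "planar_matrix p q a b ** planar_matrix p q c d =
    planar_matrix p q (a * c + b * cnj d) (a * d + b * cnj c)"
  unfolding matrix_matrix_mult_def vec_eq_iff vec_lambda_beta planar_matrix_row_sum[OF assms]
  using assms by (auto simp: planar_matrix_def algebra_simps)

lemma planar_matrix_1_0: "p \<noteq> q \<Longrightarrow> planar_matrix p q 1 0 = mat 1"
  by (auto simp: planar_matrix_def mat_def vec_eq_iff)

text \<open>The inverse of \<open>v \<mapsto> a v + b cnj v\<close> with determinant 1 is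
  \<open>v \<mapsto> cnj a v - b cnj v\<close>.\<close>

lemma invertible_planar_matrix:
  fixes p q :: "'m::finite"
  assumes "p \<noteq> q" and ab: "a * cnj a - b * cnj b = 1"
  shows "invertible (planar_matrix p q a b)"
  unfolding invertible_def
proof (intro exI conjI)
  show "planar_matrix p q a b ** planar_matrix p q (cnj a) (- b) = mat 1"
    using ab by (simp add: planar_matrix_mult assms(1) planar_matrix_1_0 algebra_simps)
  show "planar_matrix p q (cnj a) (- b) ** planar_matrix p q a b = mat 1"
    using ab by (simp add: planar_matrix_mult assms(1) planar_matrix_1_0 algebra_simps)
qed

lemma continuous_on_planar_matrix:
  fixes p q :: "'m::finite"
  assumes [continuous_intros]: "continuous_on S a" "continuous_on S b"
  shows "continuous_on S (\<lambda>x. planar_matrix p q (a x) (b x))"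
proof -
  have "continuous_on S (\<lambda>x. planar_matrix p q (a x) (b x) $ i $ j)" for i j
    unfolding planar_matrix_def vec_lambda_beta
    by (cases "i = p"; cases "i = q"; cases "j = p"; cases "j = q")
      (auto intro!: continuous_intros)
  then have "continuous_on S (\<lambda>x. (\<chi> i j. planar_matrix p q (a x) (b x) $ i $ j))"
    by (intro continuous_on_vec_lambda)
  then show ?thesis by simp
qed

text \<open>\<open>Re a\<close> and \<open>Im a\<close> are half the sum and half the difference of
  two matrix entries, so both are bounded by the operator norm.\<close>

lemma onorm_planar_matrix_lower:
  fixes p q :: "'m::finite"
  assumes "p \<noteq> q"
  shows "norm a / 2 \<le> onorm ((*v) (planar_matrix p q a b))"
proof -
  let ?M = "planar_matrix p q a b" and ?o = "onorm ((*v) (planar_matrix p q a b))"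
  have e: "?M $ p $ p = Re a + Re b" "?M $ q $ q = Re a - Re b"
    "?M $ p $ q = Im b - Im a" "?M $ q $ p = Im a + Im b"
    using assms by (auto simp: planar_matrix_def)
  have "\<bar>?M $ i $ j\<bar> \<le> ?o" for i j by (rule matrix_component_le_onorm)
  from this[of p p] this[of q q] this[of p q] this[of q p]
  have "\<bar>Re a\<bar> \<le> ?o" "\<bar>Im a\<bar> \<le> ?o" unfolding e by linarith+
  with cmod_le[of a] show ?thesis by linarith
qed

lemma onorm_planar_matrix_upper:
  fixes p q :: "'m::finite"
  assumes "1 \<le> norm a" "norm b \<le> norm a"
  shows "onorm ((*v) (planar_matrix p q a b)) \<le> real CARD('m) * real CARD('m) * (2 * norm a)"
proof (rule onorm_le_matrix_component)
  fix i j
  show "\<bar>planar_matrix p q a b $ i $ j\<bar> \<le> 2 * norm a"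
    using abs_Re_le_cmod[of a] abs_Re_le_cmod[of b] abs_Im_le_cmod[of a] abs_Im_le_cmod[of b] assms
    unfolding planar_matrix_def vec_lambda_beta by (auto split: if_splits)
qed

text \<open>The cocycle at \<open>x\<close> is Herman's cocycle at \<open>g x\<close>, and its norm
  agrees with that of the first coefficient up to a constant factor, whose logarithm disappears
  after division by \<open>n\<close>. Surjectivity of \<open>g\<close> carries uniform convergence
  from \<open>X\<close> to the circle.\<close>

lemma non_uniform_cocycle_over_rotation:
  fixes X :: "'a::metric_space set" and g :: "'a \<Rightarrow> complex"
  assumes l: "norm l = 1" and irr: "\<And>q. q \<ge> 1 \<Longrightarrow> l ^ q \<noteq> 1"
    and fX: "f ` X \<subseteq> X" and g: "continuous_on X g" "g ` X = sphere 0 1"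
    and eq: "\<And>x. x \<in> X \<Longrightarrow> g (f x) = l * g x"
    and m: "CARD('m::finite) \<ge> 2"
  shows "\<exists>A \<in> (C_GL X :: ('a \<Rightarrow> real ^ 'm ^ 'm) set). \<not> uniform_cocycle X f A"
proof -
  obtain p q :: 'm where pq: "p \<noteq> q"
    using m by (metis One_nat_def Suc_1 card_le_Suc0_iff_eq finite_class.finite_UNIV iso_tuple_UNIV_I not_less_eq_eq)
  have ng: "norm (g x) = 1" if "x \<in> X" for x
    using g(2) that by (metis dist_0_norm imageI mem_sphere)
  have fn: "(f ^^ n) x \<in> X \<and> g ((f ^^ n) x) = l ^ n * g x" if "x \<in> X" for n x
    using that fX eq by (induction n) (auto simp: image_subset_iff)
  \<comment> \<open>In the plane of \<open>p\<close> and \<open>q\<close> this is multiplication by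
    \<open>g x\<close> followed by \<open>diag(2, 1/2)\<close>.\<close>
  define A where "A = (\<lambda>x. planar_matrix p q (5/4 * g x) (3/4 * cnj (g x)))"
  have "invertible (A x)" if "x \<in> X" for x
    unfolding A_def
  proof (rule invertible_planar_matrix[OF pq])
    have "g x * cnj (g x) = 1" using ng[OF that] by (rule unimodular_mult_cnj)
    then show "5/4 * g x * cnj (5/4 * g x) - 3/4 * cnj (g x) * cnj (3/4 * cnj (g x)) = 1"
      by (simp add: algebra_simps)
  qed
  moreover have "continuous_on X A"
    unfolding A_def by (intro continuous_on_planar_matrix continuous_intros g)
  ultimately have "A \<in> C_GL X"
    by (simp add: C_GL_def)
  moreover have "\<not> uniform_cocycle X f A"
  proof
    assume "uniform_cocycle X f A"
    then obtain \<Lambda> where \<Lambda>: "uniform_limit X (\<lambda>n x. ln (onorm ((*v) (cocycle f A n x))) / real n) \<Lambda> sequentially"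
      unfolding uniform_cocycle_def uniformly_convergent_on_def by blast
    have coc: "cocycle f A n x = planar_matrix p q (herman_a l n (g x)) (herman_b l n (g x))" if "x \<in> X" for n x
    proof (induction n)
      case 0
      show ?case by (simp add: planar_matrix_1_0[OF pq])
    next
      case (Suc n)
      then show ?case
        using fn[OF that, of n] by (simp add: A_def planar_matrix_mult[OF pq] herman_a_Suc herman_b_Suc)
    qed
    define K where "K = ln (real CARD('m) * real CARD('m) * 2)"
    have m0: "real CARD('m) * real CARD('m) \<ge> 1"
      using m mult_mono[of 1 "real CARD('m)" 1 "real CARD('m)"] by simp
    then have K: "ln 2 \<le> K" unfolding K_def by (intro ln_mono) auto
    have close: "dist (ln (norm (herman_a l n (g x))) / real n) (ln (onorm ((*v) (cocycle f A n x))) / real n) \<le> K / real n"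
      if x: "x \<in> X" for n x
    proof -
      have a1: "1 \<le> norm (herman_a l n (g x))" using norm_herman_a_ge_1[OF l ng[OF x]] .
      have b1: "norm (herman_b l n (g x)) \<le> norm (herman_a l n (g x))" using norm_herman_b_le[OF l ng[OF x]] .
      have o: "norm (herman_a l n (g x)) / 2 \<le> onorm ((*v) (cocycle f A n x))"
        "onorm ((*v) (cocycle f A n x)) \<le> real CARD('m) * real CARD('m) * 2 * norm (herman_a l n (g x))"
        unfolding coc[OF x] using onorm_planar_matrix_lower[OF pq] onorm_planar_matrix_upper[OF a1 b1, of p q]
        by (auto simp: mult.assoc)
      have "ln (norm (herman_a l n (g x))) - ln 2 = ln (norm (herman_a l n (g x)) / 2)"
        using a1 by (subst ln_div) auto
      also have "\<dots> \<le> ln (onorm ((*v) (cocycle f A n x)))"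
        using o a1 by (intro ln_mono) auto
      finally have 1: "ln (norm (herman_a l n (g x))) - ln (onorm ((*v) (cocycle f A n x))) \<le> K"
        using K by linarith
      have "ln (onorm ((*v) (cocycle f A n x))) \<le> ln (real CARD('m) * real CARD('m) * 2 * norm (herman_a l n (g x)))"
        using o a1 by (intro ln_mono) (linarith+)
      also have "\<dots> = K + ln (norm (herman_a l n (g x)))"
        unfolding K_def using a1 m0 by (subst ln_mult) auto
      finally have "\<bar>ln (norm (herman_a l n (g x))) - ln (onorm ((*v) (cocycle f A n x)))\<bar> \<le> K"
        using 1 by linarith
      then have "\<bar>ln (norm (herman_a l n (g x))) - ln (onorm ((*v) (cocycle f A n x)))\<bar> / real n \<le> K / real n"
        by (intro divide_right_mono) auto
      then show ?thesis by (simp add: dist_real_def diff_divide_distrib[symmetric])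
    qed
    define s where "s = inv_into X g"
    have s: "s z \<in> X \<and> g (s z) = z" if "norm z = 1" for z
      using that g(2) unfolding s_def by (metis dist_0_norm f_inv_into_f inv_into_into mem_sphere)
    have "uniform_limit (sphere 0 1) (\<lambda>n z. ln (norm (herman_a l n z)) / real n) (\<lambda>z. \<Lambda> (s z)) sequentially"
      unfolding uniform_limit_iff
    proof (intro allI impI)
      fix e :: real assume e: "e > 0"
      have "\<forall>\<^sub>F n in sequentially. \<forall>x\<in>X. dist (ln (onorm ((*v) (cocycle f A n x))) / real n) (\<Lambda> x) < e / 2"
        using \<Lambda> e unfolding uniform_limit_iff by (meson half_gt_zero)
      moreover have "\<forall>\<^sub>F n in sequentially. K / real n < e / 2"
        using e by real_asymp
      ultimately show "\<forall>\<^sub>F n in sequentially. \<forall>z\<in>sphere 0 1. dist (ln (norm (herman_a l n z)) / real n) (\<Lambda> (s z)) < e"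
      proof eventually_elim
        case (elim n)
        show ?case
        proof
          fix z :: complex assume "z \<in> sphere 0 1"
          then have z: "s z \<in> X" "g (s z) = z" using s by auto
          from close[OF z(1), of n] elim(1)[rule_format, OF z(1)] elim(2)
          show "dist (ln (norm (herman_a l n z)) / real n) (\<Lambda> (s z)) < e"
            unfolding z(2) dist_real_def by linarith
        qed
      qed
    qed
    then show False
      using herman_a_not_uniformly_convergent[OF l irr] unfolding uniformly_convergent_on_def by blast
  qed
  ultimately show ?thesis by blast
qed

theorem theorem2:
  fixes X :: "'a::metric_space set" and f :: "'a \<Rightarrow> 'a"
  assumes "dynamical_system X f"
    and "uniquely_ergodic X f"
    and "minimal_system X f"
    and "totally_transitive X f"
    and "\<not> top_weakly_mixing X f"
    and "CARD('m::finite) \<ge> 2"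
  shows "\<exists>A \<in> (C_GL X :: ('a \<Rightarrow> real ^ 'm ^ 'm) set). \<not> uniform_cocycle X f A"
proof -
  obtain M where M: "invariant_prob X f M"
    using assms(2) by (auto simp: uniquely_ergodic_def)
  have cX: "compact X" and fX: "f ` X = X"
    using assms(1) by (auto simp: dynamical_system_def homeomorphism_def)
  obtain g and l :: complex where g: "continuous_on X g" "\<And>x. x \<in> X \<Longrightarrow> norm (g x) = 1"
      "\<And>x. x \<in> X \<Longrightarrow> g (f x) = l * g x" and l: "norm l = 1" "l \<noteq> 1"
    using ex_eigenfunction_of_not_weakly_mixing[OF assms(1) M assms(3,5)] by blast
  interpret prob_space M using M by (simp add: invariant_prob_def)
  have "sets M = sets (restrict_space borel X)" using M by (simp add: invariant_prob_def)
  from sets_eq_imp_space_eq[OF this] have "X \<noteq> {}" using not_empty by (simp add: space_restrict_space)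
  then obtain x where x: "x \<in> X" by blast
  have it: "(f ^^ n) x \<in> X \<and> g ((f ^^ n) x) = l ^ n * g x" if "x \<in> X" for n x
    using that fX g(3) by (induction n) (auto simp: image_subset_iff)
  \<comment> \<open>If \<open>l ^ q = 1\<close>, then \<open>g\<close> is invariant under
    \<open>f ^^ q\<close>, hence constant by total transitivity, which contradicts
    \<open>l \<noteq> 1\<close>.\<close>
  have irr: "l ^ q \<noteq> 1" if q: "q \<ge> 1" for q
  proof
    assume lq: "l ^ q = 1"
    have "top_transitive X (f ^^ q)" using assms(4) q by (simp add: totally_transitive_def)
    then have "g (f x) = g x"
      by (rule transitive_invariant_constant[OF _ g(1)]) (use it x fX lq in auto)
    then show False using g(2,3)[OF x] l by auto
  qed
  \<comment> \<open>The image is compact and contains a dense orbit of the rotation.\<close>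
  have "g ` X = sphere 0 1"
  proof
    show "g ` X \<subseteq> sphere 0 1" using g(2) by auto
    show "sphere 0 1 \<subseteq> g ` X"
    proof
      fix w :: complex assume "w \<in> sphere 0 1"
      then have w: "norm w = 1" by simp
      have "closed (g ` X)" using compact_continuous_image[OF g(1) cX] by (rule compact_imp_closed)
      moreover have "\<exists>y\<in>g ` X. dist y w < e" if e: "e > 0" for e
      proof -
        obtain n where "norm (l ^ n * g x - w) < e"
          using rotation_orbit_dense[OF l(1) irr g(2)[OF x] w e] by blast
        then show ?thesis using it[OF x, of n] by (metis dist_norm imageI)
      qed
      ultimately show "w \<in> g ` X" using closed_approachable by blast
    qed
  qed
  then show ?thesis
    by (intro non_uniform_cocycle_over_rotation[OF l(1) irr _ g(1) _ g(3) assms(6)]) (auto simp: fX)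
qed

end
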